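(* Let $K$ be a compact subset of $\mathbb{C}$ with width $w>0$ and diameter $d$, and let $A,B\in K$ be points with $|B-A|=d$. Let $\mu$ be a finite non-negative Borel measure on $K$ with $\mu(K)>0$, and suppose that there are $\theta\in(0,1)$ and $\delta\in(0,1)$ such that $$\mu(K_\delta)\ge \theta\,\mu(K).$$ Then for any $0<q\le\infty$ and any positive integer $n$ with $$n\ge 2\left(1+\frac1q\right)\frac{d^2}{w^2}\ln\frac{d}{w}$$ (where $1/q:=0$ for $q=\infty$) we have $$M_{n,q}(K,\mu)\le C_q(\delta,\theta)\,\frac{w}{d^2}\,n,\qquad\text{where}\quad C_q(\delta,\theta):=\frac{121}{1-\delta}\left(1+\frac{2}{\theta}\right)^{1/q}.$$
   Context: For a compact set $K\subset\mathbb{C}$: the diameter is $d=d(K):=\max_{z,z'\in K}|z-z'|$, and the width is $w=w(K):=\min_{\gamma\in[-\pi,\pi]}\max_{z,z'\in K}\left(\operatorname{Re}(ze^{i\gamma})-\operatorname{Re}(z'e^{i\gamma})\right)$. For fixed $A,B\in K$ with $|B-A|=d$ and $\delta\in(0,1)$, $$K_\delta:=\left\{z\in K:\ \operatorname{Re}\left(\left(z-\tfrac{A+B}{2}\right)e^{-i\arg(B-A)}\right)\in\left[-\tfrac{\delta d}{2},\tfrac{\delta d}{2}\right]\right\}.$$ For a finite Borel measure $\mu$ on $K$ and a polynomial $p\in\mathbb{C}[z]$: $\|p\|_q:=\left(\int_K|p(z)|^q\,\mu(dz)\right)^{1/q}$ for $0<q<\infty$, and $\|p\|_\infty:=\max_{z\in\operatorname{supp}\mu}|p(z)|$.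 $\mathcal{P}_n(K)$ denotes the set of polynomials with complex coefficients of degree exactly $n$ all of whose zeros lie in $K$, and $$M_{n,q}(K,\mu):=\inf\left\{\frac{\|p'\|_q}{\|p\|_q}:\ p\in\mathcal{P}_n(K),\ \|p\|_q\ne0\right\}.$$ *)

theory Defs
  imports "HOL-Analysis.Analysis" "HOL-Computational_Algebra.Polynomial"
begin

text \<open>For nonempty compact \<open>K\<close> the infimum and the supremum are attained.\<close>

definition set_width :: "complex set \<Rightarrow> real" where
  "set_width K =
     (INF \<gamma>\<in>{-pi..pi}. SUP (z, z')\<in>K \<times> K. Re (z * cis \<gamma>) - Re (z' * cis \<gamma>))"

definition middle_part :: "complex set \<Rightarrow> complex \<Rightarrow> complex \<Rightarrow> real \<Rightarrow> complex set" where
  "middle_part K A B \<delta> =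
     {z \<in> K. Re ((z - (A + B) / 2) * cis (- Arg (B - A)))
              \<in> {- (\<delta> * diameter K / 2) .. \<delta> * diameter K / 2}}"

text \<open>Exponents \<open>q\<close> range over \<open>(0, \<infinity>]\<close>; since \<open>inverse \<infinity> = 0\<close> in the extended reals,
  this is \<open>1/q\<close> with \<open>1/\<infinity> = 0\<close>.\<close>

definition recip_exponent :: "ereal \<Rightarrow> real" where
  "recip_exponent q = real_of_ereal (inverse q)"

definition measure_support :: "'a::topological_space measure \<Rightarrow> 'a set" where
  "measure_support \<mu> =
     {z \<in> space \<mu>. \<forall>U. open U \<and> z \<in> U \<longrightarrow> emeasure \<mu> (U \<inter> space \<mu>) > 0}"

text \<open>A measure on \<open>K\<close> has \<open>space \<mu> = K\<close>, so integration over \<open>\<mu>\<close> is integration over \<open>K\<close>.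
  The supremum in the case \<open>q = \<infinity>\<close> is a maximum whenever \<open>K\<close> is compact and \<open>\<mu> K > 0\<close>,
  since the support is then compact and nonempty.\<close>

definition poly_norm :: "complex measure \<Rightarrow> ereal \<Rightarrow> complex poly \<Rightarrow> real" where
  "poly_norm \<mu> q p =
     (if q = \<infinity> then (SUP z\<in>measure_support \<mu>. cmod (poly p z))
      else (LINT z|\<mu>. cmod (poly p z) powr real_of_ereal q) powr recip_exponent q)"

definition polys_zeros_in :: "nat \<Rightarrow> complex set \<Rightarrow> complex poly set" where
  "polys_zeros_in n K = {p. degree p = n \<and> (\<forall>z. poly p z = 0 \<longrightarrow> z \<in> K)}"

text \<open>The infimum is taken in the extended reals, so that it would be \<open>\<infinity>\<close>
  if no polynomial were admissible.\<close>

definition turan_constant :: "nat \<Rightarrow> ereal \<Rightarrow> complex set \<Rightarrow> complex measure \<Rightarrow> ereal" where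
  "turan_constant n q K \<mu> =
     (INF p\<in>{p \<in> polys_zeros_in n K. poly_norm \<mu> q p \<noteq> 0}.
        ereal (poly_norm \<mu> q (pderiv p) / poly_norm \<mu> q p))"

definition turan_bound_factor :: "ereal \<Rightarrow> real \<Rightarrow> real \<Rightarrow> real" where
  "turan_bound_factor q \<delta> \<theta> = 121 / (1 - \<delta>) * (1 + 2 / \<theta>) powr recip_exponent q"

end

theory Submission
  imports Defs
begin

text \<open>
  In the coordinate \<open>u = (z - A) / (B - A)\<close> the set \<open>K\<close> lies in the strip \<open>\<bar>Im u\<bar> \<le> \<epsilon> = w / d\<close>,
  because the smallest height of the triangle \<open>A, B, z\<close> is the one onto its longest side \<open>AB\<close>.
  Put \<open>\<eta> = (1 - \<delta>) / 2\<close>.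

  If \<open>\<eta> \<le> 30 \<epsilon>\<close>, one of \<open>(z - A)^n\<close> and \<open>(z - B)^n\<close> works: at least half of the mass of \<open>K\<^sub>\<delta>\<close> is at
  distance at least \<open>d / 2\<close> from \<open>A\<close> or from \<open>B\<close>.

  If \<open>30 \<epsilon> < \<eta>\<close>, some cell \<open>S\<close> of \<open>K\<^sub>\<delta>\<close> of length \<open>\<epsilon>\<close> in \<open>Re u\<close> carries mass at least
  \<open>\<epsilon> \<theta> \<mu>(K) / 2\<close>. Take \<open>p = (z - A)^k (z - B)^(n - k)\<close>, whose critical point \<open>c = k / n\<close> is placed within
  \<open>2 \<epsilon>\<close> of the cell. Then \<open>\<bar>p'/p\<bar> = (n / d) \<bar>u - c\<bar> / \<bar>u (1 - u)\<bar>\<close> is of order \<open>(n / d) \<epsilon> / \<eta>\<close> while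
  \<open>\<bar>Re u - c\<bar> < 8 \<epsilon>\<close>. Farther away \<open>\<bar>p\<bar>\<close> is smaller than on \<open>S\<close> by a factor \<open>exp (- n \<epsilon>\<^sup>2)\<close>, which by the
  lower bound on \<open>n\<close> is at most \<open>\<epsilon>^(1 + 1/q)\<close>: one power of \<open>\<epsilon>\<close> gives the width, and the power \<open>1/q\<close> pays
  for the small mass of \<open>S\<close>.
\<close>

subsection \<open>Width\<close>

text \<open>For \<open>a = Re e\<close> and \<open>b = Re (u * e)\<close> with
  \<open>u = x + i y\<close>, the numbers \<open>a\<close>, \<open>b\<close>, \<open>a - b\<close>
  are the projections of the sides of the triangle 0, 1, \<open>u\<close>, and the form equals
  \<open>y\<^sup>2\<close> times the squared modulus of \<open>e\<close>. Up to a common sign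
  \<open>0 \<le> a\<close>; depending on the position of \<open>b\<close>, the form is then at most
  the square of \<open>a - b\<close>, \<open>a\<close> or \<open>b\<close>.\<close>

lemma triangle_quadratic_form_le:
  fixes a b x y m :: real
  assumes "0 \<le> x" "x \<le> 1" "x\<^sup>2 + y\<^sup>2 \<le> 1" "(1 - x)\<^sup>2 + y\<^sup>2 \<le> 1"
    and "\<bar>a\<bar> \<le> m" "\<bar>b\<bar> \<le> m" "\<bar>a - b\<bar> \<le> m"
  shows "y\<^sup>2 * a\<^sup>2 + (b - x * a)\<^sup>2 \<le> m\<^sup>2"
proof -
  have main: "y\<^sup>2 * a\<^sup>2 + (b - x * a)\<^sup>2 \<le> m\<^sup>2"
    if a: "0 \<le> a" and h: "\<bar>a\<bar> \<le> m" "\<bar>b\<bar> \<le> m" "\<bar>a - b\<bar> \<le> m" for a b :: real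
  proof -
    have Q: "y\<^sup>2 * a\<^sup>2 + (b - x * a)\<^sup>2 = (x\<^sup>2 + y\<^sup>2) * a\<^sup>2 - 2 * x * (a * b) + b\<^sup>2"
      by (simp add: power2_eq_square algebra_simps)
    have xa: "(x\<^sup>2 + y\<^sup>2) * a\<^sup>2 \<le> a\<^sup>2" using assms(3) by (simp add: mult_left_le_one_le)
    have y2x: "x\<^sup>2 + y\<^sup>2 \<le> 2 * x" using assms(4) by (simp add: power2_eq_square algebra_simps)
    consider "b < 0" | "0 \<le> b" "b \<le> a" | "a \<le> b" "0 \<le> b" by linarith
    then show ?thesis
    proof cases
      case 1
      have "x * (a * (- b)) \<le> 1 * (a * (- b))" by (rule mult_right_mono) (use assms a 1 in \<open>auto simp: mult_nonneg_nonpos\<close>)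
      then have "(x\<^sup>2 + y\<^sup>2) * a\<^sup>2 - 2 * x * (a * b) + b\<^sup>2 \<le> (a - b)\<^sup>2"
        using xa by (simp add: power2_eq_square algebra_simps)
      also have "\<dots> \<le> m\<^sup>2" using h by (simp add: abs_le_square_iff[symmetric])
      finally show ?thesis using Q by simp
    next
      case 2
      \<comment> \<open>convex in \<open>b\<close>, so the endpoints \<open>b = 0\<close> and \<open>b = a\<close> suffice\<close>
      define t where "t = b / a"
      have t: "0 \<le> t" "t \<le> 1" "b = t * a" using 2 a by (auto simp: t_def divide_le_eq_1)
      have "(x\<^sup>2 + y\<^sup>2) * a\<^sup>2 - 2 * x * (a * b) + b\<^sup>2 - a\<^sup>2
          = a\<^sup>2 * ((1 - t) * (x\<^sup>2 + y\<^sup>2 - 1) + t * (x\<^sup>2 + y\<^sup>2 - 2 * x) - t * (1 - t))"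
        unfolding t(3) by algebra
      also have "\<dots> \<le> 0"
      proof (rule mult_nonneg_nonpos)
        have "(1 - t) * (x\<^sup>2 + y\<^sup>2 - 1) \<le> 0" "t * (x\<^sup>2 + y\<^sup>2 - 2 * x) \<le> 0" "0 \<le> t * (1 - t)"
          using assms(3) y2x t by (auto intro!: mult_nonneg_nonpos)
        then show "(1 - t) * (x\<^sup>2 + y\<^sup>2 - 1) + t * (x\<^sup>2 + y\<^sup>2 - 2 * x) - t * (1 - t) \<le> 0"
          by linarith
      qed simp
      finally have "(x\<^sup>2 + y\<^sup>2) * a\<^sup>2 - 2 * x * (a * b) + b\<^sup>2 \<le> a\<^sup>2" by simp
      also have "\<dots> \<le> m\<^sup>2" using h by (simp add: abs_le_square_iff[symmetric])
      finally show ?thesis using Q by simp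
    next
      case 3
      have "a * ((x\<^sup>2 + y\<^sup>2) * a) \<le> a * (2 * x * a)"
        using a y2x by (intro mult_left_mono mult_right_mono)
      also have "\<dots> \<le> a * (2 * x * b)" using a 3 assms by (intro mult_left_mono) auto
      finally have "(x\<^sup>2 + y\<^sup>2) * a\<^sup>2 - 2 * x * (a * b) + b\<^sup>2 \<le> b\<^sup>2"
        by (simp add: power2_eq_square algebra_simps)
      also have "\<dots> \<le> m\<^sup>2" using h by (simp add: abs_le_square_iff[symmetric])
      finally show ?thesis using Q by simp
    qed
  qed
  show ?thesis
  proof (cases "0 \<le> a")
    case True
    then show ?thesis using main assms by blast
  next
    case False
    have "y\<^sup>2 * (- a)\<^sup>2 + (- b - x * (- a))\<^sup>2 \<le> m\<^sup>2"
      by (rule main) (use False assms in auto)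
    moreover have "(- b - x * (- a))\<^sup>2 = (b - x * a)\<^sup>2" by algebra
    ultimately show ?thesis by simp
  qed
qed

text \<open>The maximum is the extent of the triangle 0, 1, \<open>u\<close> in the direction given
  by \<open>e\<close>. Since \<open>cmod e = 1\<close>, the quadratic form collapses to the square
  of \<open>Im u\<close>.\<close>

lemma triangle_width_ge:
  fixes u e :: complex
  assumes "cmod u \<le> 1" "cmod (1 - u) \<le> 1" "cmod e = 1"
  shows "\<bar>Im u\<bar> \<le> max \<bar>Re e\<bar> (max \<bar>Re (u * e)\<bar> \<bar>Re ((1 - u) * e)\<bar>)" (is "_ \<le> ?m")
proof -
  define x y where "x = Re u" and "y = Im u"
  have n: "x\<^sup>2 + y\<^sup>2 \<le> 1" "(1 - x)\<^sup>2 + y\<^sup>2 \<le> 1" "(Re e)\<^sup>2 + (Im e)\<^sup>2 = 1"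
    using power_mono[OF assms(1), of 2] power_mono[OF assms(2), of 2] assms(3)
    by (auto simp: cmod_power2 x_def y_def cmod_def)
  have "x\<^sup>2 \<le> 1\<^sup>2" "(1 - x)\<^sup>2 \<le> 1\<^sup>2" using n by (auto intro: order_trans[rotated])
  then have "\<bar>x\<bar> \<le> 1" "\<bar>1 - x\<bar> \<le> 1" unfolding abs_le_square_iff[symmetric] by auto
  then have x: "0 \<le> x" "x \<le> 1" by auto
  have "y\<^sup>2 * (Re e)\<^sup>2 + (Re (u * e) - x * Re e)\<^sup>2 \<le> ?m\<^sup>2"
    by (rule triangle_quadratic_form_le[OF x n(1,2)]) (auto simp: algebra_simps)
  moreover have "Re (u * e) - x * Re e = - y * Im e" by (simp add: x_def y_def)
  moreover have "y\<^sup>2 * (Re e)\<^sup>2 + (- y * Im e)\<^sup>2 = y\<^sup>2 * ((Re e)\<^sup>2 + (Im e)\<^sup>2)" by algebra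
  ultimately have "y\<^sup>2 \<le> ?m\<^sup>2" using n(3) by simp
  then show ?thesis unfolding abs_le_square_iff[symmetric] y_def by (simp add: max_def)
qed

text \<open>In each direction \<open>K\<close> extends at least as far as the triangle
  \<open>A\<close>, \<open>B\<close>, \<open>z\<close>, whose longest side is \<open>AB\<close>; the
  infimum over directions is taken last.\<close>

lemma Im_le_set_width:
  assumes K: "compact K" and AB: "A \<in> K" "B \<in> K" "cmod (B - A) = diameter K" "diameter K > 0"
    and z: "z \<in> K"
  defines "u \<equiv> (z - A) / (B - A)"
  shows "diameter K * \<bar>Im u\<bar> \<le> set_width K" "cmod u \<le> 1" "cmod (1 - u) \<le> 1"
proof -
  have nz: "B \<noteq> A" using AB by auto
  have "1 - u = (B - z) / (B - A)" using nz by (simp add: u_def field_simps)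
  have dist: "cmod (v - w) \<le> diameter K" if "v \<in> K" "w \<in> K" for v w
    using diameter_bounded_bound[OF compact_imp_bounded[OF K] that] by (simp add: dist_norm)
  show 1: "cmod u \<le> 1" using dist[OF z AB(1)] AB by (simp add: u_def norm_divide)
  show 2: "cmod (1 - u) \<le> 1"
    using dist[OF AB(2) z] AB by (simp add: \<open>1 - u = _\<close> norm_divide)
  have "diameter K * \<bar>Im u\<bar> \<le> (SUP (z, z')\<in>K \<times> K. Re (z * cis \<gamma>) - Re (z' * cis \<gamma>))" for \<gamma>
  proof -
    define R where "R = (SUP (z, z')\<in>K \<times> K. Re (z * cis \<gamma>) - Re (z' * cis \<gamma>))"
    \<comment> \<open>The unit number \<open>e\<close> combines the direction of \<open>AB\<close>
      with the rotation by \<gamma>, so that projections of differences in \<open>K\<close> are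
      projections in the coordinate \<open>u\<close>, scaled by the diameter.\<close>
    define e where "e = (B - A) / diameter K * cis \<gamma>"
    have e: "cmod e = 1" using AB by (simp add: e_def norm_mult norm_divide)
    have bdd: "bdd_above ((\<lambda>(z, z'). Re (z * cis \<gamma>) - Re (z' * cis \<gamma>)) ` (K \<times> K))"
    proof (rule bdd_aboveI2)
      fix s assume "s \<in> K \<times> K"
      then obtain v w where s: "s = (v, w)" "v \<in> K" "w \<in> K" by auto
      have "Re ((v - w) * cis \<gamma>) \<le> cmod ((v - w) * cis \<gamma>)" by (rule complex_Re_le_cmod)
      also have "\<dots> \<le> diameter K" using dist[OF s(2,3)] by (simp add: norm_mult)
      finally show "(case s of (z, z') \<Rightarrow> Re (z * cis \<gamma>) - Re (z' * cis \<gamma>)) \<le> diameter K"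
        by (simp add: s algebra_simps)
    qed
    have "Re ((v - w) * cis \<gamma>) \<le> R" if "v \<in> K" "w \<in> K" for v w
      unfolding R_def using cSUP_upper[OF _ bdd, of "(v, w)"] that by (simp add: algebra_simps)
    \<comment> \<open>Exchanging the two points flips the sign, which gives the bound for the
      absolute value.\<close>
    from this[of v w for v w] this[of w v for v w]
    have abs: "\<bar>Re ((v - w) * cis \<gamma>)\<bar> \<le> R" if "v \<in> K" "w \<in> K" for v w
      using that by (smt (verit) minus_diff_eq mult_minus_left uminus_complex.sel(1))
    have eq: "diameter K * Re (((v - w) / (B - A)) * e) = Re ((v - w) * cis \<gamma>)" for v w
    proof -
      have "diameter K * Re c = Re (complex_of_real (diameter K) * c)" for c by simp
      also have "complex_of_real (diameter K) * (((v - w) / (B - A)) * e) = (v - w) * cis \<gamma>"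
        using nz AB(4) by (simp add: e_def)
      finally show ?thesis .
    qed
    have "\<bar>diameter K * Re (((v - w) / (B - A)) * e)\<bar> \<le> R" if "v \<in> K" "w \<in> K" for v w
      using abs[OF that] unfolding eq .
    then have "diameter K * \<bar>Re (((v - w) / (B - A)) * e)\<bar> \<le> R" if "v \<in> K" "w \<in> K" for v w
      using that AB(4) by (simp add: abs_mult)
    from this[OF AB(2,1)] this[OF z AB(1)] this[OF AB(2) z]
    have "diameter K * \<bar>Re e\<bar> \<le> R" "diameter K * \<bar>Re (u * e)\<bar> \<le> R"
      "diameter K * \<bar>Re ((1 - u) * e)\<bar> \<le> R"
      using nz by (auto simp: u_def[symmetric] \<open>1 - u = _\<close>[symmetric])
    then have "diameter K * max \<bar>Re e\<bar> (max \<bar>Re (u * e)\<bar> \<bar>Re ((1 - u) * e)\<bar>) \<le> R"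
      by (auto simp: max_def)
    moreover have "diameter K * \<bar>Im u\<bar> \<le> diameter K * max \<bar>Re e\<bar> (max \<bar>Re (u * e)\<bar> \<bar>Re ((1 - u) * e)\<bar>)"
      using triangle_width_ge[OF 1 2 e] AB(4) by (intro mult_left_mono) auto
    ultimately show ?thesis unfolding R_def by linarith
  qed
  then show "diameter K * \<bar>Im u\<bar> \<le> set_width K"
    unfolding set_width_def by (intro cINF_greatest) auto
qed

lemma set_width_pos_imp_diameter_pos:
  assumes "compact K" "A \<in> K" "set_width K > 0"
  shows "diameter K > 0"
proof (rule ccontr)
  assume "\<not> diameter K > 0"
  then have "dist v w \<le> 0" if "v \<in> K" "w \<in> K" for v w
    using diameter_bounded_bound[OF compact_imp_bounded[OF assms(1)] that] by linarith
  then have "K = {A}" using assms(2) by auto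
  then have "set_width K = 0" by (simp add: set_width_def)
  then show False using assms by simp
qed

text \<open>Rotation by \<open>- Arg (B - A)\<close> turns \<open>B - A\<close> into the positive
  real \<open>diameter K\<close>; the midpoint of \<open>AB\<close> then sits at 1/2 in the
  normalised coordinate.\<close>

lemma middle_part_iff:
  assumes "cmod (B - A) = diameter K" "diameter K > 0"
  shows "z \<in> middle_part K A B \<delta> \<longleftrightarrow> z \<in> K \<and>
    (1 - \<delta>) / 2 \<le> Re ((z - A) / (B - A)) \<and> Re ((z - A) / (B - A)) \<le> 1 - (1 - \<delta>) / 2"
proof -
  have nz: "B \<noteq> A" using assms by auto
  have BA: "B - A = complex_of_real (diameter K) * cis (Arg (B - A))"
    using rcis_cmod_Arg[of "B - A"] assms by (simp add: rcis_def)
  have "(z - (A + B) / 2) * cis (- Arg (B - A))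
      = ((z - A) / (B - A) - 1 / 2) * ((B - A) * cis (- Arg (B - A)))"
    using nz by (simp add: field_simps)
  also have "(B - A) * cis (- Arg (B - A)) = complex_of_real (diameter K)"
    by (subst BA) (simp add: mult.assoc cis_mult)
  finally have "Re ((z - (A + B) / 2) * cis (- Arg (B - A)))
      = (Re ((z - A) / (B - A)) - 1 / 2) * diameter K" by simp
  then have *: "Re ((z - (A + B) / 2) * cis (- Arg (B - A)))
      = diameter K * (Re ((z - A) / (B - A)) - 1 / 2)" by simp
  have l: "\<delta> * diameter K / 2 = diameter K * (\<delta> / 2)"
    "- (diameter K * (\<delta> / 2)) = diameter K * (- \<delta> / 2)" by auto
  show ?thesis
    unfolding middle_part_def mem_Collect_eq * l atLeastAtMost_iff
      mult_le_cancel_left_pos[OF assms(2)] by (auto simp: field_simps)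
qed

subsection \<open>Comparison of norms\<close>

text \<open>Each point of the space outside the support has an open neighbourhood of measure zero.
  By the Lindelof property countably many of these suffice to cover such points, so a measurable set
  missing the support is null.\<close>

lemma support_meets:
  fixes \<mu> :: "'a::second_countable_topology measure"
  assumes sets: "sets \<mu> = sets (restrict_space borel K)"
    and S: "S \<in> sets \<mu>" "measure \<mu> S > 0"
  shows "S \<inter> measure_support \<mu> \<noteq> {}"
proof
  assume E: "S \<inter> measure_support \<mu> = {}"
  have sp: "space \<mu> = K"
    using sets_eq_imp_space_eq[OF sets] by (simp add: space_restrict_space)
  define F where "F = {U. open U \<and> emeasure \<mu> (U \<inter> space \<mu>) = 0}"
  obtain F' where F': "F' \<subseteq> F" "countable F'" "\<Union>F' = \<Union>F"
    using Lindelof[of F] unfolding F_def by blast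
  have meas: "U \<inter> K \<in> sets \<mu>" if "open U" for U
    using that by (auto simp: sets sets_restrict_space)
  have null: "(\<Union>U\<in>F'. U \<inter> K) \<in> null_sets \<mu>"
    using F'(1) meas by (intro null_sets_UN' F'(2) null_setsI) (auto simp: F_def sp)
  have "S \<subseteq> (\<Union>U\<in>F'. U \<inter> K)"
  proof
    fix z assume z: "z \<in> S"
    have zK: "z \<in> K" using z sets.sets_into_space[OF S(1)] sp by auto
    then obtain U where "open U" "z \<in> U" "\<not> 0 < emeasure \<mu> (U \<inter> space \<mu>)"
      using z E unfolding measure_support_def sp by blast
    then have "z \<in> \<Union>F'" using F'(3) by (auto simp: F_def zero_less_iff_neq_zero)
    with zK show "z \<in> (\<Union>U\<in>F'. U \<inter> K)" by auto
  qed
  with null S(1) have "S \<in> null_sets \<mu>" by (rule null_sets_subset)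
  then show False using S(2) by (simp add: measure_def null_setsD1)
qed

text \<open>At each point \<open>p'\<close> is controlled either by \<open>p\<close> at the same
  point or by all values of \<open>p\<close> on \<open>S\<close>, with a gain of
  \<open>\<kappa> powr (1/q)\<close>. In the second case the \<open>q\<close>-th power is averaged
  over \<open>S\<close>, and the gain \<kappa> cancels the factor \<kappa> in the mass of
  \<open>S\<close>. The two cases contribute 1 and \<open>2 / \<theta>\<close>.\<close>

lemma poly_norm_ratio_le:
  fixes p p' :: "complex poly"
  assumes "compact K" "finite_measure \<mu>" and sets: "sets \<mu> = sets (restrict_space borel K)"
    and M: "measure \<mu> K > 0"
    and S: "S \<in> sets \<mu>" "measure \<mu> S \<ge> \<theta> * \<kappa> / 2 * measure \<mu> K"
    and pos: "0 < \<theta>" "0 < \<kappa>" "0 < q" "0 \<le> C"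
    and nz: "\<And>w. w \<in> S \<Longrightarrow> poly p w \<noteq> 0"
    and bound: "\<And>z. z \<in> K \<Longrightarrow> cmod (poly p' z) \<le> C * cmod (poly p z) \<or>
        (\<forall>w\<in>S. cmod (poly p' z) \<le> C * \<kappa> powr recip_exponent q * cmod (poly p w))"
  shows "poly_norm \<mu> q p \<noteq> 0"
    and "poly_norm \<mu> q p' / poly_norm \<mu> q p \<le> C * (1 + 2 / \<theta>) powr recip_exponent q"
proof -
  interpret finite_measure \<mu> by fact
  have sp: "space \<mu> = K"
    using sets_eq_imp_space_eq[OF sets] by (simp add: space_restrict_space)
  have Spos: "measure \<mu> S > 0"
    by (rule less_le_trans[OF _ S(2)]) (use M pos in simp)
  have SK: "S \<subseteq> K" using sets.sets_into_space[OF S(1)] sp by simp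
  have bdd: "\<exists>B. \<forall>z\<in>K. cmod (poly r z) \<le> B" for r :: "complex poly"
  proof -
    have "compact (poly r ` K)"
      by (intro compact_continuous_image continuous_intros \<open>compact K\<close>)
    then show ?thesis by (auto dest!: compact_imp_bounded simp: bounded_iff)
  qed
  have "poly_norm \<mu> q p > 0 \<and> poly_norm \<mu> q p' \<le> C * (1 + 2 / \<theta>) powr recip_exponent q * poly_norm \<mu> q p"
  proof (cases "q = \<infinity>")
    case True
    \<comment> \<open>For an infinite exponent the gain \<open>\<kappa> powr 0\<close> is 1, and a
      single point of \<open>S\<close> in the support is enough.\<close>
    have r0: "recip_exponent q = 0" using True by (simp add: recip_exponent_def)
    have N: "poly_norm \<mu> q r = (SUP z\<in>measure_support \<mu>. cmod (poly r z))" for r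
      using True by (simp add: poly_norm_def)
    have suppK: "measure_support \<mu> \<subseteq> K" by (auto simp: measure_support_def sp)
    obtain w where w: "w \<in> S" "w \<in> measure_support \<mu>"
      using support_meets[OF sets S(1) Spos] by auto
    have le: "cmod (poly p z) \<le> poly_norm \<mu> q p" if "z \<in> measure_support \<mu>" for z
    proof -
      obtain B where "\<forall>z\<in>K. cmod (poly p z) \<le> B" using bdd by blast
      then have "bdd_above ((\<lambda>z. cmod (poly p z)) ` measure_support \<mu>)"
        using suppK by (auto intro!: bdd_aboveI[of _ B])
      then show ?thesis unfolding N by (rule cSUP_upper[OF that])
    qed
    have "0 < cmod (poly p w)" using nz[OF w(1)] by simp
    then have pp: "0 < poly_norm \<mu> q p" using le[OF w(2)] by linarith
    have "poly_norm \<mu> q p' \<le> C * poly_norm \<mu> q p"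
      unfolding N[of p']
    proof (rule cSUP_least)
      show "measure_support \<mu> \<noteq> {}" using w by auto
      fix z assume z: "z \<in> measure_support \<mu>"
      have "cmod (poly p' z) \<le> C * cmod (poly p z) \<or> cmod (poly p' z) \<le> C * cmod (poly p w)"
        using bound[of z] z suppK w pos unfolding r0 by auto
      moreover have "C * cmod (poly p z) \<le> C * poly_norm \<mu> q p"
        "C * cmod (poly p w) \<le> C * poly_norm \<mu> q p"
        using le[OF z] le[OF w(2)] pos by (auto intro: mult_left_mono)
      ultimately show "cmod (poly p' z) \<le> C * poly_norm \<mu> q p" by linarith
    qed
    moreover have "1 + 2 / \<theta> > 0" using pos by (simp add: add_pos_pos)
    ultimately show ?thesis using pp unfolding r0 by simp
  next
    case False
    define r where "r = real_of_ereal q"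
    have q: "q = ereal r" and r: "r > 0" using False pos by (cases q; auto simp: r_def)+
    have s: "recip_exponent q = 1 / r" using r by (simp add: recip_exponent_def q inverse_eq_divide)
    define J where "J f = (LINT z|\<mu>. cmod (poly f z) powr r)" for f
    have N: "poly_norm \<mu> q f = J f powr (1/r)" for f
      using False by (simp add: poly_norm_def J_def s r_def)
    have meas: "(\<lambda>z. cmod (poly f z) powr r) \<in> borel_measurable \<mu>" for f
    proof -
      have "poly f \<in> borel_measurable borel"
        by (intro borel_measurable_continuous_onI continuous_intros)
      then have "poly f \<in> borel_measurable \<mu>"
        unfolding measurable_cong_sets[OF sets refl] by (rule measurable_restrict_space1)
      then show ?thesis by measurable
    qed
    have int: "integrable \<mu> (\<lambda>z. cmod (poly f z) powr r)" for f
    proof -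
      obtain B where B: "\<forall>z\<in>K. cmod (poly f z) \<le> B" using bdd by blast
      show ?thesis
        by (rule integrable_const_bound[of _ "B powr r"])
          (use B r in \<open>auto simp: sp meas intro!: AE_I2 powr_mono2\<close>)
    qed
    have intS: "integrable \<mu> (\<lambda>z. indicator S z * cmod (poly p z) powr r)"
      using integrable_mult_indicator[OF S(1) int[of p]] by simp
    have JS: "(LINT z|\<mu>. indicator S z * cmod (poly p z) powr r) \<le> J p"
      unfolding J_def by (intro integral_mono intS int) (auto simp: indicator_def)
    \<comment> \<open>A zero integral would make \<open>p\<close> vanish almost everywhere, but
      \<open>p\<close> has no zero on \<open>S\<close>, which has positive measure.\<close>
    have Jpos: "J p > 0"
    proof (rule ccontr)
      assume "\<not> J p > 0"
      moreover have "J p \<ge> 0" unfolding J_def by (intro integral_nonneg_AE) simp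
      ultimately have "J p = 0" by simp
      then have "AE z in \<mu>. cmod (poly p z) powr r = 0"
        unfolding J_def by (subst (asm) integral_nonneg_eq_0_iff_AE[OF int]) auto
      then have "AE z in \<mu>. z \<notin> S" by eventually_elim (use nz in auto)
      then have "S \<in> null_sets \<mu>" using S(1) by (simp add: AE_iff_null_sets)
      then show False using Spos by (simp add: measure_def null_setsD1)
    qed
    have pw: "cmod (poly p' z) powr r \<le> C powr r * cmod (poly p z) powr r
        + C powr r * (2 / \<theta>) * J p / measure \<mu> K" if z: "z \<in> K" for z
    proof (cases "cmod (poly p' z) \<le> C * cmod (poly p z)")
      case True
      then have "cmod (poly p' z) powr r \<le> (C * cmod (poly p z)) powr r"
        using r by (intro powr_mono2) auto
      also have "\<dots> = C powr r * cmod (poly p z) powr r" using pos by (simp add: powr_mult)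
      finally show ?thesis using Jpos M pos
        by (smt (verit) divide_nonneg_pos mult_nonneg_nonneg powr_ge_zero)
    next
      case False
      have *: "cmod (poly p' z) powr r \<le> C powr r * \<kappa> * cmod (poly p w) powr r" if "w \<in> S" for w
      proof -
        have "cmod (poly p' z) powr r \<le> (C * \<kappa> powr (1/r) * cmod (poly p w)) powr r"
          using r bound[OF z] False that by (intro powr_mono2) (auto simp: s)
        also have "\<dots> = C powr r * \<kappa> * cmod (poly p w) powr r"
          using pos r by (simp add: powr_mult powr_powr)
        finally show ?thesis .
      qed
      \<comment> \<open>The left side of \<open>*\<close> does not depend on \<open>w\<close>, so
        integration over \<open>S\<close> multiplies it by the mass of \<open>S\<close>.\<close>
      have "measure \<mu> S * cmod (poly p' z) powr r
          = (LINT w|\<mu>. indicator S w * cmod (poly p' z) powr r)"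
        using S(1) by (simp add: sets.Int_space_eq2)
      also have "\<dots> \<le> (LINT w|\<mu>. C powr r * \<kappa> * (indicator S w * cmod (poly p w) powr r))"
      proof (rule integral_mono)
        have "integrable \<mu> (indicator S :: complex \<Rightarrow> real)"
          using S(1) by (intro integrable_real_indicator) (simp_all add: emeasure_eq_measure)
        then show "integrable \<mu> (\<lambda>w. indicator S w * cmod (poly p' z) powr r)" by simp
        show "integrable \<mu> (\<lambda>w. C powr r * \<kappa> * (indicator S w * cmod (poly p w) powr r))"
          by (intro integrable_mult_right intS)
      qed (use * in \<open>auto simp: indicator_def\<close>)
      also have "\<dots> \<le> C powr r * \<kappa> * J p"
        using JS pos by (simp add: mult_left_mono)
      finally have 1: "measure \<mu> S * cmod (poly p' z) powr r \<le> C powr r * \<kappa> * J p" .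
      have "\<theta> * \<kappa> / 2 * measure \<mu> K * cmod (poly p' z) powr r \<le> C powr r * \<kappa> * J p"
        using mult_right_mono[OF S(2), of "cmod (poly p' z) powr r"] 1 by simp
      then have "\<kappa> * (\<theta> / 2 * measure \<mu> K * cmod (poly p' z) powr r) \<le> \<kappa> * (C powr r * J p)"
        by (simp add: mult_ac)
      then have "\<theta> / 2 * measure \<mu> K * cmod (poly p' z) powr r \<le> C powr r * J p"
        using pos by simp
      then have "cmod (poly p' z) powr r \<le> C powr r * (2 / \<theta>) * J p / measure \<mu> K"
        using M pos by (simp add: field_simps)
      then show ?thesis by (simp add: add_increasing)
    qed
    \<comment> \<open>The second summand is constant in \<open>z\<close>; its integral loses the
      denominator \<open>measure \<mu> K\<close>.\<close>
    have "J p' \<le> (LINT z|\<mu>. C powr r * cmod (poly p z) powr r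
        + C powr r * (2 / \<theta>) * J p / measure \<mu> K)"
      unfolding J_def[of p'] using pw sp
      by (intro integral_mono Bochner_Integration.integrable_add integrable_mult_right int) auto
    also have "\<dots> = C powr r * J p + C powr r * (2 / \<theta>) * J p"
      using M int[of p] by (subst Bochner_Integration.integral_add) (auto simp: J_def sp)
    finally have "J p' \<le> C powr r * (1 + 2 / \<theta>) * J p" by (simp add: algebra_simps)
    moreover have "J p' \<ge> 0" unfolding J_def by (intro integral_nonneg_AE) simp
    ultimately have "J p' powr (1/r) \<le> (C powr r * (1 + 2 / \<theta>) * J p) powr (1/r)"
      using r by (intro powr_mono2) auto
    also have "\<dots> = C * (1 + 2 / \<theta>) powr (1/r) * J p powr (1/r)"
      using r pos Jpos by (simp add: powr_mult powr_powr)
    finally show ?thesis using Jpos r by (simp add: N s)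
  qed
  then show "poly_norm \<mu> q p \<noteq> 0"
    and "poly_norm \<mu> q p' / poly_norm \<mu> q p \<le> C * (1 + 2 / \<theta>) powr recip_exponent q"
    by (auto simp: divide_le_eq)
qed

subsection \<open>Decay away from the critical point\<close>

text \<open>Both sides agree at 1, and their difference has derivative
  \<open>(1 - 1 / x)\<^sup>2 / 2\<close>. Unlike \<open>ln z \<le> z - 1\<close>, the bound is exact
  to second order.\<close>

lemma ln_le_half_diff_inverse:
  fixes z :: real
  assumes "1 \<le> z"
  shows "ln z \<le> (z - 1 / z) / 2"
proof -
  have "(1 - 1 / 1) / 2 - ln 1 \<le> (z - 1 / z) / 2 - ln z"
  proof (rule DERIV_nonneg_imp_nondecreasing[OF assms])
    fix x :: real assume x: "1 \<le> x" "x \<le> z"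
    have "((\<lambda>x. (x - 1 / x) / 2 - ln x) has_real_derivative (1 - 1 / x)\<^sup>2 / 2) (at x)"
      using x by (auto intro!: derivative_eq_intros simp: field_simps power2_eq_square)
    then show "\<exists>y. ((\<lambda>x. (x - 1 / x) / 2 - ln x) has_real_derivative y) (at x) \<and> 0 \<le> y"
      by (intro exI[of _ "(1 - 1 / x)\<^sup>2 / 2"]) simp
  qed
  then show ?thesis by simp
qed

text \<open>Both sides agree at 0, and their difference has derivative
  \<open>x\<^sup>2 / (1 - x)\<close>. The quadratic term is kept because the linear one cancels at
  the critical point.\<close>

lemma ln_one_minus_le:
  fixes s :: real
  assumes "0 \<le> s" "s < 1"
  shows "ln (1 - s) \<le> - s - s\<^sup>2 / 2"
proof -
  have "- 0 - 0\<^sup>2 / 2 - ln (1 - 0) \<le> - s - s\<^sup>2 / 2 - ln (1 - s)"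
  proof (rule DERIV_nonneg_imp_nondecreasing[OF assms(1)])
    fix x :: real assume x: "0 \<le> x" "x \<le> s"
    have "((\<lambda>x. - x - x\<^sup>2 / 2 - ln (1 - x)) has_real_derivative x\<^sup>2 / (1 - x)) (at x)"
      using x assms by (auto intro!: derivative_eq_intros simp: field_simps power2_eq_square)
    then show "\<exists>y. ((\<lambda>x. - x - x\<^sup>2 / 2 - ln (1 - x)) has_real_derivative y) (at x) \<and> 0 \<le> y"
      using x assms by (intro exI[of _ "x\<^sup>2 / (1 - x)"]) simp
  qed
  then show ?thesis by simp
qed

text \<open>Twice \<open>ln (r / x)\<close> is \<open>ln (1 + (y / x)\<^sup>2)\<close>; the extra
  term is the price of leaving the real axis.\<close>

lemma ln_hypotenuse_le:
  fixes x y r :: real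
  assumes "0 < x" "0 < r" "r\<^sup>2 = x\<^sup>2 + y\<^sup>2"
  shows "ln r \<le> ln x + y\<^sup>2 / (2 * x\<^sup>2)"
proof -
  have "2 * (ln r - ln x) = ln ((r / x)\<^sup>2)" using assms by (simp add: ln_realpow ln_div)
  also have "\<dots> \<le> (r / x)\<^sup>2 - 1" using assms by (intro ln_le_minus_one) simp
  also have "\<dots> = y\<^sup>2 / x\<^sup>2" using assms by (simp add: power_divide field_simps)
  finally show ?thesis by (simp add: field_simps)
qed

text \<open>With \<open>r = cmod u\<close>, \<open>s = cmod (1 - u)\<close> and
  \<open>c = k / N\<close>, this is the logarithm of the \<open>N\<close>-th root of
  \<open>r ^ k * s ^ (N - k)\<close>. Along \<open>r = x\<close>, \<open>s = 1 - x\<close> it is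
  largest at \<open>x = c\<close>.\<close>

definition log_potential :: "real \<Rightarrow> real \<Rightarrow> real \<Rightarrow> real" where
  "log_potential c r s = c * ln r + (1 - c) * ln s"

lemma power_mult_power_eq_exp:
  assumes "0 < r" "0 < s" "k + m > 0"
  shows "r ^ k * s ^ m = exp (real (k + m) * log_potential (real k / real (k + m)) r s)"
proof -
  define N where "N = real (k + m)"
  have N: "N > 0" "real k = N - real m" using assms by (auto simp: N_def)
  have "N * log_potential (real k / N) r s = real k * ln r + real m * ln s"
    using N(1) unfolding log_potential_def N(2) by (simp add: field_simps)
  then show ?thesis
    using assms unfolding N_def[symmetric] by (simp add: exp_add exp_of_nat_mult)
qed

text \<open>The loss is the relative entropy of the weights \<open>(c, 1 - c)\<close> with respect
  to \<open>(x, 1 - x)\<close>, which is at most the chi-square distance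
  \<open>(x - c)\<^sup>2 / (x * (1 - x))\<close>.\<close>

lemma log_potential_near_ge:
  fixes c x \<epsilon> \<eta> :: real
  assumes c: "0 < c" "c < 1" and x: "\<eta> \<le> x" "x \<le> 1 - \<eta>" "\<bar>x - c\<bar> \<le> 2 * \<epsilon>" and e: "0 < \<epsilon>" "30 * \<epsilon> < \<eta>"
  shows "log_potential c x (1 - x) \<ge> log_potential c c (1 - c) - 5 * \<epsilon>\<^sup>2 * (1 / c + 1 / (1 - c))"
proof -
  have x01: "0 < x" "x < 1" using x e by auto
  have "log_potential c c (1 - c) - log_potential c x (1 - x)
      = c * ln (c / x) + (1 - c) * ln ((1 - c) / (1 - x))"
    using c x01 by (simp add: log_potential_def ln_div algebra_simps)
  also have "\<dots> \<le> c * (c / x - 1) + (1 - c) * ((1 - c) / (1 - x) - 1)"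
    using c x01 by (intro add_mono mult_left_mono ln_le_minus_one) auto
  also have "\<dots> = (x - c)\<^sup>2 * (1 / x + 1 / (1 - x))"
    using x01 by (simp add: divide_simps) algebra
  also have "\<dots> \<le> (2 * \<epsilon>)\<^sup>2 * (5 / 4 * (1 / c + 1 / (1 - c)))"
  proof (rule mult_mono)
    show "(x - c)\<^sup>2 \<le> (2 * \<epsilon>)\<^sup>2" unfolding abs_le_square_iff[symmetric] using x(3) e by simp
    \<comment> \<open>Both \<open>x\<close> and \<open>1 - x\<close> exceed
      \<open>30 * \<epsilon>\<close>, so a shift by \<open>2 * \<epsilon>\<close> enlarges either by
      a factor below 5/4.\<close>
    have "1 / x \<le> 5 / 4 * (1 / c)" "1 / (1 - x) \<le> 5 / 4 * (1 / (1 - c))"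
      using x e c x01 by (auto simp: divide_simps)
    then show "1 / x + 1 / (1 - x) \<le> 5 / 4 * (1 / c + 1 / (1 - c))"
      unfolding distrib_left by (rule add_mono)
  qed (use x01 in auto)
  also have "\<dots> = 5 * \<epsilon>\<^sup>2 * (1 / c + 1 / (1 - c))" by (simp add: power2_eq_square)
  finally show ?thesis by linarith
qed

text \<open>Along the real axis the potential drops by at least \<open>t\<^sup>2/2 (1/x + 1/(1 - c))\<close>, where \<open>t = x - c\<close>.
  The imaginary part \<open>y\<close> gives back less than half of this, because \<open>\<bar>y\<bar> \<le> t / 8\<close> and
  \<open>\<bar>y\<bar> \<le> 2/7 (1 - x)\<close>.\<close>

lemma log_potential_far_le:
  fixes c x y r s \<epsilon> :: real
  assumes e: "0 < \<epsilon>" and c: "28 * \<epsilon> \<le> c" and x: "c + 8 * \<epsilon> \<le> x" "7 / 2 * \<epsilon> \<le> 1 - x" and y: "\<bar>y\<bar> \<le> \<epsilon>"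
    and r: "0 < r" "r\<^sup>2 = x\<^sup>2 + y\<^sup>2" and s: "0 < s" "s\<^sup>2 = (1 - x)\<^sup>2 + y\<^sup>2"
  shows "log_potential c r s \<le> log_potential c c (1 - c) - 10 * \<epsilon>\<^sup>2 * (1 / c + 1 / (1 - c))"
proof -
  define t where "t = x - c"
  have pos: "0 < c" "c < x" "x < 1" "c < 1" "0 < t" using assms by (auto simp: t_def)
  have t: "8 * \<epsilon> \<le> t" "x = c + t" using x by (auto simp: t_def)
  have y2: "y\<^sup>2 \<le> \<epsilon>\<^sup>2" using y e by (simp add: abs_le_square_iff[symmetric])
  have t2: "64 * \<epsilon>\<^sup>2 \<le> t\<^sup>2" using power_mono[OF t(1), of 2] e by (simp add: power2_eq_square)
  have 1: "c * ln (x / c) \<le> c * ((x / c - 1 / (x / c)) / 2)"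
    using pos by (intro mult_left_mono ln_le_half_diff_inverse) auto
  have "(1 - c) * ln (1 - t / (1 - c)) \<le> (1 - c) * (- (t / (1 - c)) - (t / (1 - c))\<^sup>2 / 2)"
    using pos t by (intro mult_left_mono ln_one_minus_le) auto
  moreover have "1 - t / (1 - c) = (1 - x) / (1 - c)" using pos by (simp add: t_def field_simps)
  ultimately have 2: "(1 - c) * ln ((1 - x) / (1 - c)) \<le> (1 - c) * (- (t / (1 - c)) - (t / (1 - c))\<^sup>2 / 2)"
    by simp
  \<comment> \<open>The linear term \<open>t\<close> here cancels against \<open>- t\<close> in
    \<open>e2\<close>, as \<open>c\<close> is the critical point.\<close>
  have e1: "c * ((x / c - 1 / (x / c)) / 2) = t - t\<^sup>2 / (2 * x)"
    using pos unfolding t_def by (simp add: divide_simps) algebra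
  have e2: "(1 - c) * (- (t / (1 - c)) - (t / (1 - c))\<^sup>2 / 2) = - t - t\<^sup>2 / (2 * (1 - c))"
    using pos by (simp add: divide_simps) algebra
  have main: "log_potential c x (1 - x) - log_potential c c (1 - c) \<le> - t\<^sup>2 / (2 * x) - t\<^sup>2 / (2 * (1 - c))"
    using 1 2 pos unfolding e1 e2 by (simp add: log_potential_def ln_div algebra_simps)
  have l1: "c * ln r \<le> c * (ln x + y\<^sup>2 / (2 * x\<^sup>2))"
    using pos r by (intro mult_left_mono ln_hypotenuse_le) auto
  have l2: "(1 - c) * ln s \<le> (1 - c) * (ln (1 - x) + y\<^sup>2 / (2 * (1 - x)\<^sup>2))"
    using pos s by (intro mult_left_mono ln_hypotenuse_le) auto
  have c1: "c * (y\<^sup>2 / (2 * x\<^sup>2)) \<le> 1 / 64 * (t\<^sup>2 / (2 * x))"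
  proof -
    have "c * y\<^sup>2 \<le> x * (t\<^sup>2 / 64)" using pos y2 t2 by (intro mult_mono) auto
    then show ?thesis using pos by (simp add: field_simps power2_eq_square)
  qed
  have c2: "(1 - c) * (y\<^sup>2 / (2 * (1 - x)\<^sup>2)) \<le> 17 / 100 * (t\<^sup>2 / (2 * (1 - c)))"
  proof -
    \<comment> \<open>Splitting \<open>1 - c\<close> into \<open>t\<close> and \<open>1 - x\<close>
      gives the factor 2/7 + 1/8 = 23/56, whose square is below 17/100.\<close>
    have a1: "t * \<epsilon> \<le> t * ((1 - x) * (2 / 7))" using pos x by (intro mult_left_mono) auto
    have a2: "(1 - x) * \<epsilon> \<le> (1 - x) * (t / 8)" using pos t by (intro mult_left_mono) auto
    have "(1 - c) * \<epsilon> = t * \<epsilon> + (1 - x) * \<epsilon>" by (simp add: t_def algebra_simps)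
    also have "\<dots> \<le> 23 / 56 * (t * (1 - x))" using a1 a2 by (simp add: algebra_simps)
    finally have "((1 - c) * \<epsilon>)\<^sup>2 \<le> (23 / 56 * (t * (1 - x)))\<^sup>2"
      using pos e by (intro power_mono) auto
    also have "\<dots> = (23 / 56)\<^sup>2 * (t * (1 - x))\<^sup>2" by (rule power_mult_distrib)
    also have "\<dots> \<le> 17 / 100 * (t * (1 - x))\<^sup>2"
      by (intro mult_right_mono) (simp_all add: power_divide)
    finally have "(1 - c)\<^sup>2 * \<epsilon>\<^sup>2 \<le> 17 / 100 * t\<^sup>2 * (1 - x)\<^sup>2" by (simp add: power_mult_distrib)
    moreover have "(1 - c)\<^sup>2 * y\<^sup>2 \<le> (1 - c)\<^sup>2 * \<epsilon>\<^sup>2" using y2 by (intro mult_left_mono) auto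
    ultimately have "(1 - c)\<^sup>2 * y\<^sup>2 \<le> 17 / 100 * t\<^sup>2 * (1 - x)\<^sup>2" by linarith
    then have "(1 - c) * y\<^sup>2 / (1 - x)\<^sup>2 * (1 - c) \<le> 17 / 100 * t\<^sup>2"
      using pos by (simp add: divide_le_eq power2_eq_square mult_ac)
    then have "(1 - c) * y\<^sup>2 / (1 - x)\<^sup>2 \<le> 17 / 100 * t\<^sup>2 / (1 - c)"
      using pos by (subst pos_le_divide_eq) auto
    then have "(1 - c) * y\<^sup>2 / (1 - x)\<^sup>2 / 2 \<le> 17 / 100 * t\<^sup>2 / (1 - c) / 2"
      by (rule divide_right_mono) simp
    then show ?thesis by simp
  qed
  \<comment> \<open>Here \<open>x = c + t\<close> is split; the two parts use 25/64 and 25/224 of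
    \<open>t\<^sup>2 * c\<close>.\<close>
  have d1: "25 * \<epsilon>\<^sup>2 * (1 / c) \<le> t\<^sup>2 / x"
  proof -
    have "\<epsilon> * \<epsilon> * t \<le> (c / 28) * (t / 8) * t" using pos c t e by (intro mult_mono) auto
    moreover have "\<epsilon>\<^sup>2 * c \<le> t\<^sup>2 / 64 * c" using pos t2 by (intro mult_right_mono) auto
    moreover have "0 \<le> t\<^sup>2 * c" using pos by simp
    ultimately have "25 * \<epsilon>\<^sup>2 * x \<le> t\<^sup>2 * c" unfolding t(2) by (simp add: power2_eq_square algebra_simps)
    then show ?thesis using pos by (simp add: field_simps)
  qed
  have d2: "64 * \<epsilon>\<^sup>2 * (1 / (1 - c)) \<le> t\<^sup>2 / (1 - c)" using t2 pos by (simp add: divide_right_mono)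
  have n: "0 \<le> t\<^sup>2 / x" "0 \<le> t\<^sup>2 / (1 - c)" "0 \<le> \<epsilon>\<^sup>2 * (1 / (1 - c))" using pos by auto
  have m: "log_potential c r s \<le> log_potential c x (1 - x)
      + c * (y\<^sup>2 / (2 * x\<^sup>2)) + (1 - c) * (y\<^sup>2 / (2 * (1 - x)\<^sup>2))"
    using l1 l2 by (simp add: log_potential_def algebra_simps)
  have half: "v / (2 * w) = v / w / 2" for v w :: real by simp
  \<comment> \<open>After the corrections \<open>U\<close> and \<open>V\<close> the drop is at least
    63/128 of \<open>X\<close> plus 83/200 of \<open>Y\<close>; multiplied by 25 and 64 both
    coefficients exceed 10.\<close>
  have arith: "L \<le> G - 10 * e * (p + q)"
    if "L \<le> H + U + V" "H - G \<le> - X / 2 - Y / 2" "U \<le> 1 / 64 * (X / 2)" "V \<le> 17 / 100 * (Y / 2)"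
      "25 * e * p \<le> X" "64 * e * q \<le> Y" "0 \<le> X" "0 \<le> Y" "0 \<le> e * q"
    for L G H U V X Y e p q :: real
    using that by (simp add: algebra_simps)
  have "- t\<^sup>2 / (2 * x) - t\<^sup>2 / (2 * (1 - c)) = - (t\<^sup>2 / x) / 2 - t\<^sup>2 / (1 - c) / 2"
    unfolding half by simp
  note main' = main[unfolded this] and c1' = c1[unfolded half] and c2' = c2[unfolded half]
  show ?thesis by (rule arith[OF m[unfolded half] main' c1' c2' d1 d2 n])
qed

text \<open>The term \<open>(1 - c) * ln ((1 - c) / \<rho>)\<close> is at least
  \<open>3/2 * (1 - c)\<close>, and \<open>- c * ln c\<close> uses up at most \<open>1 - c\<close>
  of it. This serves points near 1, where \<open>1 - Re u\<close> may be below
  \<open>7/2 * \<epsilon>\<close>.\<close>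

lemma log_potential_end_le:
  fixes c \<rho> :: real
  assumes c: "0 < c" "c < 1" and \<rho>: "0 < \<rho>" "7 * \<rho> \<le> 1 - c"
  shows "(1 - c) * ln \<rho> \<le> log_potential c c (1 - c) - (1 - c) / 2"
proof -
  \<comment> \<open>From e \<le> 3 alone: the cube of e is at most 27, below 49.\<close>
  have "(exp (3 / 2 :: real))\<^sup>2 = exp 1 ^ 3" by (simp flip: exp_of_nat_mult)
  also have "\<dots> \<le> 3 ^ 3" using exp_le by (intro power_mono) auto
  also have "\<dots> \<le> 7\<^sup>2" by simp
  finally have "exp (3 / 2 :: real) \<le> 7" by (rule power2_le_imp_le) simp
  then have "3 / 2 \<le> ln (7 :: real)" by (subst ln_ge_iff) auto
  also have "\<dots> \<le> ln ((1 - c) / \<rho>)" using \<rho> by (simp add: le_divide_eq)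
  finally have "(1 - c) * (3 / 2) \<le> (1 - c) * (ln (1 - c) - ln \<rho>)"
    using c \<rho> by (intro mult_left_mono) (auto simp: ln_div)
  then have "(1 - c) * (3 / 2) \<le> (1 - c) * ln (1 - c) - (1 - c) * ln \<rho>"
    by (simp only: right_diff_distrib)
  moreover have "c * ln (1 / c) \<le> c * (1 / c - 1)"
    using c by (intro mult_left_mono ln_le_minus_one) auto
  then have "- (c * ln c) \<le> 1 - c" using c by (simp add: ln_div algebra_simps)
  moreover have "P \<le> R + Q - d / 2" if "d * (3 / 2) \<le> Q - P" "- R \<le> d" for P Q R d :: real
    using that by linarith
  ultimately show ?thesis unfolding log_potential_def by blast
qed

text \<open>The exponents on the left are lower by one because differentiation removes a factor
  \<open>u * (1 - u)\<close>; restoring it costs \<open>20 / \<eta>\<close>. The potential drops by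
  \<open>10 * \<epsilon>\<^sup>2 * (1 / c + 1 / (1 - c))\<close> far away and by at most half of
  that at \<open>w\<close>, which leaves more than \<epsilon>\<epsilon>.\<close>

lemma far_right_power_le:
  fixes u w :: complex and a b :: nat and \<epsilon> \<eta> :: real
  defines "N \<equiv> real (Suc a + Suc b)"
  defines "c \<equiv> real (Suc a) / N"
  assumes e: "0 < \<epsilon>" "30 * \<epsilon> < \<eta>" "\<eta> \<le> 1 / 2"
    and c: "\<eta> - \<epsilon> \<le> c" "c \<le> 1 - \<eta> + \<epsilon>"
    and u: "\<bar>Im u\<bar> \<le> \<epsilon>" "cmod u \<le> 1" "cmod (1 - u) \<le> 1" "c + 8 * \<epsilon> \<le> Re u"
    and w: "\<eta> \<le> Re w" "Re w \<le> 1 - \<eta>" "\<bar>Re w - c\<bar> \<le> 2 * \<epsilon>"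
  shows "cmod u ^ a * cmod (1 - u) ^ b
    \<le> 20 / \<eta> * exp (- N * \<epsilon>\<^sup>2) * (cmod w ^ Suc a * cmod (1 - w) ^ Suc b)"
proof -
  define x where "x = Re w"
  define G where "G = log_potential c c (1 - c)"
  \<comment> \<open>The radius is large enough that \<open>\<rho> \<le> cmod (1 - u)\<close> forces
    \<open>7/2 * \<epsilon> \<le> 1 - Re u\<close>, and small enough that
    \<open>7 * \<rho> \<le> 1 - c\<close>.\<close>
  define \<rho> where "\<rho> = \<eta> / 8"
  have N: "N > 0" by (simp add: N_def)
  have c01: "29 * \<epsilon> \<le> c" "29 * \<epsilon> \<le> 1 - c" "0 < c" "c < 1" using e c by auto
  have k: "real (Suc a) = N * c" "real (Suc b) = N * (1 - c)" using N
    by (auto simp: c_def N_def field_simps)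
  have inv: "2 \<le> 1 / c + 1 / (1 - c)"
  proof -
    have "1 \<le> 1 / c" "1 \<le> 1 / (1 - c)" using c01 by auto
    then show ?thesis by linarith
  qed
  have "exp (N * (G - 5 * \<epsilon>\<^sup>2 * (1 / c + 1 / (1 - c)))) \<le> exp (N * log_potential c x (1 - x))"
    using log_potential_near_ge[OF c01(3,4) w(1,2,3) e(1,2)] N by (simp add: G_def x_def)
  also have "\<dots> = x ^ Suc a * (1 - x) ^ Suc b"
    using w e power_mult_power_eq_exp[of x "1 - x" "Suc a" "Suc b"]
    by (simp only: N_def c_def x_def)
  also have "\<dots> \<le> cmod w ^ Suc a * cmod (1 - w) ^ Suc b"
    using w e complex_Re_le_cmod[of w] complex_Re_le_cmod[of "1 - w"] unfolding x_def
    by (intro mult_mono power_mono) auto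
  finally have W: "exp (N * (G - 5 * \<epsilon>\<^sup>2 * (1 / c + 1 / (1 - c)))) \<le> cmod w ^ Suc a * cmod (1 - w) ^ Suc b" .
  have "cmod u ^ a * cmod (1 - u) ^ b
    \<le> 20 / \<eta> * exp (- N * \<epsilon>\<^sup>2) * exp (N * (G - 5 * \<epsilon>\<^sup>2 * (1 / c + 1 / (1 - c))))"
  proof (cases "\<rho> \<le> cmod (1 - u)")
    case True
    have Re1: "Re u \<le> 1" using u(2) complex_Re_le_cmod[of u] by linarith
    have "(15 / 4 * \<epsilon>)\<^sup>2 \<le> (cmod (1 - u))\<^sup>2"
      using True e by (intro power_mono) (auto simp: \<rho>_def)
    moreover have "(Im u)\<^sup>2 \<le> \<epsilon>\<^sup>2" using u(1) e by (simp add: abs_le_square_iff[symmetric])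
    moreover have "(15 / 4 * \<epsilon>)\<^sup>2 = 225 / 16 * \<epsilon>\<^sup>2" "(7 / 2 * \<epsilon>)\<^sup>2 = 49 / 4 * \<epsilon>\<^sup>2"
      by (auto simp: power2_eq_square)
    moreover have "(cmod (1 - u))\<^sup>2 = (1 - Re u)\<^sup>2 + (Im u)\<^sup>2" by (simp add: cmod_power2)
    ultimately have "(7 / 2 * \<epsilon>)\<^sup>2 \<le> (1 - Re u)\<^sup>2"
      using zero_le_power2[of \<epsilon>] by linarith
    then have x35: "7 / 2 * \<epsilon> \<le> 1 - Re u"
      by (rule power2_le_imp_le) (use Re1 in simp)
    have n: "0 < cmod u" "0 < cmod (1 - u)"
      using True e u(4) c01 complex_Re_le_cmod[of u] by (auto simp: \<rho>_def)
    have "log_potential c (cmod u) (cmod (1 - u)) \<le> G - 10 * \<epsilon>\<^sup>2 * (1 / c + 1 / (1 - c))"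
      unfolding G_def
      by (rule log_potential_far_le[OF e(1) _ u(4) x35 u(1) n(1) _ n(2)])
        (use c01 e in \<open>auto simp: cmod_power2\<close>)
    moreover have "\<epsilon>\<^sup>2 * 2 \<le> \<epsilon>\<^sup>2 * (1 / c + 1 / (1 - c))" using inv by (intro mult_left_mono) auto
    ultimately have "log_potential c (cmod u) (cmod (1 - u))
        \<le> - \<epsilon>\<^sup>2 + (G - 5 * \<epsilon>\<^sup>2 * (1 / c + 1 / (1 - c)))"
      using zero_le_power2[of \<epsilon>] by linarith
    then have "N * log_potential c (cmod u) (cmod (1 - u))
        \<le> N * (- \<epsilon>\<^sup>2 + (G - 5 * \<epsilon>\<^sup>2 * (1 / c + 1 / (1 - c))))"
      using N by (intro mult_left_mono) auto
    then have E: "cmod u ^ Suc a * cmod (1 - u) ^ Suc b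
        \<le> exp (- N * \<epsilon>\<^sup>2) * exp (N * (G - 5 * \<epsilon>\<^sup>2 * (1 / c + 1 / (1 - c))))"
      using power_mult_power_eq_exp[OF n, of "Suc a" "Suc b"]
      unfolding N_def[symmetric] c_def[symmetric] by (simp flip: exp_add add: algebra_simps)
    \<comment> \<open>The two moduli add up to at least 1, so one is at least 1/2; the other is at
      least \<open>\<eta> / 10\<close>.\<close>
    have "\<eta> / 20 \<le> cmod u * cmod (1 - u)"
    proof (cases "1 / 2 \<le> cmod u")
      case True
      then have "1 / 2 * \<rho> \<le> cmod u * cmod (1 - u)"
        using \<open>\<rho> \<le> _\<close> e by (intro mult_mono) (auto simp: \<rho>_def)
      then show ?thesis using e by (simp add: \<rho>_def)
    next
      case False
      have "1 / 2 \<le> cmod (1 - u)" using False norm_triangle_ineq[of u "1 - u"] by simp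
      moreover have "\<eta> / 10 \<le> cmod u" using u(4) c e complex_Re_le_cmod[of u] by linarith
      ultimately have "\<eta> / 10 * (1 / 2) \<le> cmod u * cmod (1 - u)"
        using e by (intro mult_mono) auto
      then show ?thesis by simp
    qed
    then have "\<eta> / 20 * (cmod u ^ a * cmod (1 - u) ^ b)
        \<le> cmod u * cmod (1 - u) * (cmod u ^ a * cmod (1 - u) ^ b)"
      by (intro mult_right_mono) auto
    also have "\<dots> = cmod u ^ Suc a * cmod (1 - u) ^ Suc b" by simp
    finally show ?thesis using E e by (simp add: field_simps)
  next
    case False
    have \<rho>: "0 < \<rho>" "7 * \<rho> \<le> 1 - c" using e c by (auto simp: \<rho>_def)
    \<comment> \<open>These bounds make all terms in \<open>\<epsilon>\<^sup>2\<close> small against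
      the gain \<open>(1 - c) / 2\<close> near the endpoint.\<close>
    have "\<epsilon> * \<epsilon> \<le> (1 - c) / 29 * (c / 29)" "\<epsilon> * \<epsilon> \<le> (1 - c) / 29 * ((1 - c) / 29)"
      using c01 e by (intro mult_mono; simp)+
    then have "\<epsilon>\<^sup>2 * (1 / c) \<le> (1 - c) / 841" "\<epsilon>\<^sup>2 * (1 / (1 - c)) \<le> (1 - c) / 841"
      using c01 by (auto simp: power2_eq_square field_simps)
    moreover have "\<epsilon>\<^sup>2 * 2 \<le> \<epsilon>\<^sup>2 * (1 / c + 1 / (1 - c))" using inv by (intro mult_left_mono) auto
    moreover have "L \<le> - h + (G - 5 * h * (p + q))"
      if "h * p \<le> v / 841" "h * q \<le> v / 841" "h * 2 \<le> h * (p + q)" "L \<le> G - v / 2" "0 < v"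
      for h p q v L :: real
      using that by (simp add: algebra_simps)
    moreover have "0 < 1 - c" using c01 by simp
    ultimately have "(1 - c) * ln \<rho> \<le> - \<epsilon>\<^sup>2 + (G - 5 * \<epsilon>\<^sup>2 * (1 / c + 1 / (1 - c)))"
      using log_potential_end_le[OF c01(3,4) \<rho>] unfolding G_def[symmetric] by blast
    then have E: "exp (N * ((1 - c) * ln \<rho>)) \<le> exp (N * (- \<epsilon>\<^sup>2 + (G - 5 * \<epsilon>\<^sup>2 * (1 / c + 1 / (1 - c)))))"
      using N by simp
    \<comment> \<open>The power of \<open>u\<close> is bounded by 1, and passing from exponent
      \<open>b\<close> to \<open>Suc b\<close> costs \<open>1 / \<rho> = 8 / \<eta>\<close>.\<close>
    have "cmod u ^ a * cmod (1 - u) ^ b \<le> 1 * \<rho> ^ b"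
      using False u by (intro mult_mono power_mono power_le_one) auto
    also have "\<dots> = 8 / \<eta> * \<rho> ^ Suc b" using e by (simp add: \<rho>_def)
    also have "\<rho> ^ Suc b = exp (N * ((1 - c) * ln \<rho>))"
    proof -
      have "\<rho> ^ Suc b = exp (real (Suc b) * ln \<rho>)"
        using \<rho> by (simp only: exp_of_nat_mult exp_ln)
      then show ?thesis by (simp only: k mult.assoc)
    qed
    also have "8 / \<eta> * \<dots> \<le> 20 / \<eta> * exp (N * (- \<epsilon>\<^sup>2 + (G - 5 * \<epsilon>\<^sup>2 * (1 / c + 1 / (1 - c)))))"
      using e by (intro mult_mono E divide_right_mono) auto
    also have "\<dots> = 20 / \<eta> * exp (- N * \<epsilon>\<^sup>2) * exp (N * (G - 5 * \<epsilon>\<^sup>2 * (1 / c + 1 / (1 - c))))"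
      by (simp flip: exp_add add: algebra_simps)
    finally show ?thesis .
  qed
  also have "\<dots> \<le> 20 / \<eta> * exp (- N * \<epsilon>\<^sup>2) * (cmod w ^ Suc a * cmod (1 - w) ^ Suc b)"
    using W e by (intro mult_left_mono) auto
  finally show ?thesis .
qed

text \<open>Points to the left of \<open>c\<close> are handled by the reflection of \<open>u\<close>
  to \<open>1 - u\<close>, which swaps \<open>a\<close> with \<open>b\<close> and \<open>c\<close>
  with \<open>1 - c\<close>.\<close>

lemma far_power_le:
  fixes u w :: complex and a b :: nat and \<epsilon> \<eta> :: real
  defines "N \<equiv> real (Suc a + Suc b)"
  defines "c \<equiv> real (Suc a) / N"
  assumes e: "0 < \<epsilon>" "30 * \<epsilon> < \<eta>" "\<eta> \<le> 1 / 2"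
    and c: "\<eta> - \<epsilon> \<le> c" "c \<le> 1 - \<eta> + \<epsilon>"
    and u: "\<bar>Im u\<bar> \<le> \<epsilon>" "cmod u \<le> 1" "cmod (1 - u) \<le> 1" "8 * \<epsilon> \<le> \<bar>Re u - c\<bar>"
    and w: "\<eta> \<le> Re w" "Re w \<le> 1 - \<eta>" "\<bar>Re w - c\<bar> \<le> 2 * \<epsilon>"
  shows "cmod u ^ a * cmod (1 - u) ^ b
    \<le> 20 / \<eta> * exp (- N * \<epsilon>\<^sup>2) * (cmod w ^ Suc a * cmod (1 - w) ^ Suc b)"
proof (cases "c \<le> Re u")
  case True
  show ?thesis unfolding N_def
    by (rule far_right_power_le) (use True assms in \<open>auto simp: N_def c_def\<close>)
next
  case False
  have N: "N = real (Suc b + Suc a)" "N > 0" by (auto simp: N_def)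
  have c': "real (Suc b) / real (Suc b + Suc a) = 1 - c"
    unfolding c_def N(1) by (simp add: field_simps)
  have "cmod (1 - u) ^ b * cmod (1 - (1 - u)) ^ a
    \<le> 20 / \<eta> * exp (- N * \<epsilon>\<^sup>2) * (cmod (1 - w) ^ Suc b * cmod (1 - (1 - w)) ^ Suc a)"
    unfolding N(1)
    by (rule far_right_power_le; (unfold c')?) (use False assms in auto)
  then show ?thesis by (simp add: mult_ac)
qed

subsection \<open>The two families of polynomials\<close>

lemma turan_constant_le:
  assumes "degree p = n" "\<And>z. poly p z = 0 \<Longrightarrow> z \<in> K" "poly_norm \<mu> q p \<noteq> 0"
    and "poly_norm \<mu> q (pderiv p) / poly_norm \<mu> q p \<le> R"
  shows "turan_constant n q K \<mu> \<le> ereal R"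
  unfolding turan_constant_def
  by (rule INF_lower2[of p]) (use assms in \<open>auto simp: polys_zeros_in_def\<close>)

text \<open>For the \<open>n\<close>-th power of \<open>z - A\<close> the ratio of derivative to
  polynomial has modulus \<open>n / cmod (z - A)\<close>. Inside the disc of radius
  \<open>d / 2\<close> about \<open>A\<close> the derivative is compared with the values on
  \<open>S\<close>, which lies outside the open disc; the mass of \<open>S\<close> is not small, so
  \<kappa> is 1.\<close>

lemma turan_constant_le_one_point:
  assumes "compact K" "finite_measure \<mu>" "sets \<mu> = sets (restrict_space borel K)"
    and "measure \<mu> K > 0" "0 < \<theta>" "0 < q" "A \<in> K" "0 < d" "0 < n"
    and S: "S \<in> sets \<mu>" "measure \<mu> S \<ge> \<theta> / 2 * measure \<mu> K"
    and far: "\<And>w. w \<in> S \<Longrightarrow> d / 2 \<le> cmod (w - A)"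
  shows "turan_constant n q K \<mu> \<le> ereal (2 * real n / d * (1 + 2 / \<theta>) powr recip_exponent q)"
proof -
  obtain m where m: "n = Suc m" using \<open>0 < n\<close> by (cases n) auto
  define p where "p = [:- A, 1:] ^ n"
  have p: "cmod (poly p z) = cmod (z - A) ^ n" for z
    by (simp add: p_def poly_power norm_power)
  have p': "cmod (poly (pderiv p) z) = real n * cmod (z - A) ^ m" for z
    unfolding p_def m pderiv_power_Suc
    by (simp add: poly_power norm_mult norm_power pderiv_pCons del: of_nat_Suc)
  have bound: "cmod (poly (pderiv p) z) \<le> 2 * real n / d * cmod (poly p z) \<or>
     (\<forall>w\<in>S. cmod (poly (pderiv p) z)
        \<le> 2 * real n / d * 1 powr recip_exponent q * cmod (poly p w))" for z
  proof (cases "d / 2 \<le> cmod (z - A)")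
    case True
    then have "cmod (z - A) ^ m * d \<le> cmod (z - A) ^ m * (2 * cmod (z - A))"
      by (intro mult_left_mono) auto
    then have "real n * (cmod (z - A) ^ m * d) \<le> real n * (cmod (z - A) ^ m * (2 * cmod (z - A)))"
      by (rule mult_left_mono) simp
    then show ?thesis using \<open>0 < d\<close> unfolding p p' by (simp add: m field_simps)
  next
    case False
    have "cmod (poly (pderiv p) z) \<le> 2 * real n / d * cmod (poly p w)" if "w \<in> S" for w
    proof -
      have "cmod (poly (pderiv p) z) \<le> real n * (d / 2) ^ m"
        unfolding p' using False by (intro mult_left_mono power_mono) auto
      also have "\<dots> = 2 * real n / d * (d / 2) ^ n" using \<open>0 < d\<close> by (simp add: m)
      also have "\<dots> \<le> 2 * real n / d * cmod (poly p w)"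
        unfolding p using \<open>0 < d\<close> far[OF that] by (intro mult_left_mono power_mono) auto
      finally show ?thesis .
    qed
    then show ?thesis by simp
  qed
  have nz: "poly p w \<noteq> 0" if "w \<in> S" for w
    using far[OF that] \<open>0 < d\<close> by (auto simp: p_def poly_power)
  note norm = poly_norm_ratio_le[OF assms(1-4) S(1) _ assms(5) zero_less_one \<open>0 < q\<close> _ nz bound]
  show ?thesis
  proof (rule turan_constant_le)
    show "degree p = n" by (simp add: p_def degree_power_eq)
    show "z \<in> K" if "poly p z = 0" for z using that \<open>A \<in> K\<close> by (simp add: p_def poly_power)
    show "poly_norm \<mu> q p \<noteq> 0" by (rule norm) (use S \<open>0 < d\<close> in auto)
    show "poly_norm \<mu> q (pderiv p) / poly_norm \<mu> q p
        \<le> 2 * real n / d * (1 + 2 / \<theta>) powr recip_exponent q"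
      by (rule norm) (use S \<open>0 < d\<close> in auto)
  qed
qed

text \<open>In the coordinate \<open>u\<close> the derivative is, up to a constant,
  \<open>u ^ a * (1 - u) ^ b * (u - c)\<close> with critical point
  \<open>c = Suc a / N\<close>.\<close>

lemma cmod_two_point_poly:
  fixes A B z :: complex and a b :: nat
  defines "p \<equiv> [:- A, 1:] ^ Suc a * [:- B, 1:] ^ Suc b"
  defines "u \<equiv> (z - A) / (B - A)" and "d \<equiv> cmod (B - A)" and "N \<equiv> real (Suc a + Suc b)"
  assumes "A \<noteq> B"
  shows "cmod (poly p z) = d ^ Suc (Suc (a + b)) * (cmod u ^ Suc a * cmod (1 - u) ^ Suc b)"
    and "cmod (poly (pderiv p) z) = N * d ^ Suc (a + b) * cmod (u - of_real (real (Suc a) / N))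
           * (cmod u ^ a * cmod (1 - u) ^ b)"
proof -
  define D where "D = B - A"
  have z: "z - A = D * u" "z - B = - (D * (1 - u))"
    using \<open>A \<noteq> B\<close> by (auto simp: D_def u_def field_simps)
  have "cmod (poly p z) = cmod (z - A) ^ Suc a * cmod (z - B) ^ Suc b"
    unfolding p_def poly_mult poly_power norm_mult norm_power by simp
  then show "cmod (poly p z) = d ^ Suc (Suc (a + b)) * (cmod u ^ Suc a * cmod (1 - u) ^ Suc b)"
    unfolding z by (simp add: d_def D_def norm_mult power_mult_distrib power_add)
  have "N \<noteq> 0" and abs_N: "\<bar>N\<bar> = N" by (simp_all add: N_def)
  from \<open>N \<noteq> 0\<close> have "of_nat (Suc a) = complex_of_real (N * (real (Suc a) / N))"
    by (simp del: of_nat_Suc of_real_mult of_real_divide)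
  then have N: "of_nat (Suc a) = complex_of_real N * of_real (real (Suc a) / N)"
    "of_nat (Suc b) = complex_of_real N - of_nat (Suc a)"
    by (simp only: of_real_mult) (simp add: N_def)
  have "poly (pderiv p) z = of_nat (Suc a) * (z - A) ^ a * (z - B) ^ Suc b
      + of_nat (Suc b) * (z - B) ^ b * (z - A) ^ Suc a"
    unfolding p_def pderiv_mult pderiv_power_Suc
    by (simp add: poly_power pderiv_pCons del: of_nat_Suc power_Suc)
  also have "\<dots> = (z - A) ^ a * (z - B) ^ b * (of_nat (Suc a) * (z - B) + of_nat (Suc b) * (z - A))"
    by (simp add: algebra_simps)
  also have "of_nat (Suc a) * (z - B) + of_nat (Suc b) * (z - A)
      = D * (of_real N * u - of_nat (Suc a))"
    unfolding z N(2) by (simp add: algebra_simps)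
  also have "\<dots> = D * (of_real N * (u - of_real (real (Suc a) / N)))"
    by (subst N(1)) (simp only: right_diff_distrib)
  finally have "cmod (poly (pderiv p) z) = cmod (z - A) ^ a * cmod (z - B) ^ b
      * (d * (N * cmod (u - of_real (real (Suc a) / N))))"
    by (simp only: norm_mult norm_power d_def D_def norm_of_real abs_N)
  then show "cmod (poly (pderiv p) z) = N * d ^ Suc (a + b) * cmod (u - of_real (real (Suc a) / N))
      * (cmod u ^ a * cmod (1 - u) ^ b)"
    unfolding z by (simp add: d_def D_def norm_mult power_mult_distrib power_add)
qed

text \<open>This is the dichotomy required for comparing norms, with \<kappa> = \<epsilon> and
  \<open>s\<close> in the role of \<open>1/q\<close>. Within \<open>8 * \<epsilon>\<close> of
  \<open>c\<close> the factor \<open>u - c\<close> is small; farther out the decay of the powers is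
  used.\<close>

lemma two_point_poly_deriv_bound:
  fixes A B z :: complex and a b :: nat and \<epsilon> \<eta> s :: real
  defines "u \<equiv> \<lambda>z. (z - A) / (B - A)" and "d \<equiv> cmod (B - A)" and "N \<equiv> real (Suc a + Suc b)"
  defines "c \<equiv> real (Suc a) / N" and "p \<equiv> [:- A, 1:] ^ Suc a * [:- B, 1:] ^ Suc b"
  assumes AB: "A \<noteq> B"
    and e: "0 < \<epsilon>" "30 * \<epsilon> < \<eta>" "\<eta> \<le> 1 / 2"
    and c: "\<eta> - \<epsilon> \<le> c" "c \<le> 1 - \<eta> + \<epsilon>"
    and N: "exp (- N * \<epsilon>\<^sup>2) \<le> \<epsilon> * \<epsilon> powr s"
    and u: "\<bar>Im (u z)\<bar> \<le> \<epsilon>" "cmod (u z) \<le> 1" "cmod (1 - u z) \<le> 1"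
    and S: "\<And>w. w \<in> S \<Longrightarrow> \<eta> \<le> Re (u w) \<and> Re (u w) \<le> 1 - \<eta> \<and> \<bar>Re (u w) - c\<bar> \<le> 2 * \<epsilon>"
  defines "C \<equiv> 121 / (2 * \<eta>) * \<epsilon> * N / d"
  shows "cmod (poly (pderiv p) z) \<le> C * cmod (poly p z) \<or>
    (\<forall>w\<in>S. cmod (poly (pderiv p) z) \<le> C * \<epsilon> powr s * cmod (poly p w))"
proof -
  note pnorm = cmod_two_point_poly(1)[OF AB, of a b, folded p_def]
  note pderiv_norm = cmod_two_point_poly(2)[OF AB, of a b, folded p_def]
  define v where "v = u z"
  define Q where "Q = cmod v ^ a * cmod (1 - v) ^ b"
  have d: "d > 0" using AB by (simp add: d_def)
  have N0: "N > 0" by (simp add: N_def)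
  have c01: "0 < c" "c < 1" using c e by auto
  have Q0: "0 \<le> Q" by (simp add: Q_def)
  have p': "cmod (poly (pderiv p) z) = N * d ^ Suc (a + b) * (cmod (v - of_real c) * Q)"
    using pderiv_norm[of z] by (simp add: c_def N_def Q_def d_def v_def u_def)
  show ?thesis
  proof (cases "8 * \<epsilon> \<le> \<bar>Re v - c\<bar>")
    case True
    have "cmod (poly (pderiv p) z) \<le> C * \<epsilon> powr s * cmod (poly p w)" if w: "w \<in> S" for w
    proof -
      define W where "W = cmod (u w) ^ Suc a * cmod (1 - u w) ^ Suc b"
      have W0: "0 \<le> W" by (simp add: W_def)
      have "Q \<le> 20 / \<eta> * exp (- N * \<epsilon>\<^sup>2) * W"
        unfolding Q_def W_def
        by (rule far_power_le[where a = a and b = b, folded N_def, folded c_def])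
          (use e c u True S[OF w] in \<open>simp_all add: v_def\<close>)
      also have "\<dots> \<le> 121 / (2 * \<eta>) * (\<epsilon> * \<epsilon> powr s) * W"
        using N e W0 by (intro mult_right_mono mult_mono) (auto simp: field_simps)
      finally have Q: "Q \<le> 121 / (2 * \<eta>) * (\<epsilon> * \<epsilon> powr s) * W" .
      \<comment> \<open>A convex combination of \<open>v - 1\<close> and \<open>v\<close>, both of
        modulus at most 1.\<close>
      have "v - of_real c = of_real c * (v - 1) + of_real (1 - c) * v" by (simp add: algebra_simps)
      then have "cmod (v - of_real c) \<le> c * cmod (v - 1) + (1 - c) * cmod v"
        using c01 norm_triangle_ineq[of "of_real c * (v - 1)" "of_real (1 - c) * v"]
        by (simp only: norm_mult norm_of_real)
      also have "\<dots> \<le> c * 1 + (1 - c) * 1"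
        using c01 u by (intro add_mono mult_left_mono) (auto simp: v_def norm_minus_commute)
      finally have "cmod (v - of_real c) \<le> 1" by simp
      then have "cmod (v - of_real c) * Q \<le> 1 * Q" using Q0 by (intro mult_right_mono)
      also have "\<dots> \<le> 121 / (2 * \<eta>) * (\<epsilon> * \<epsilon> powr s) * W" using Q by simp
      finally have "cmod (poly (pderiv p) z)
          \<le> N * d ^ Suc (a + b) * (121 / (2 * \<eta>) * (\<epsilon> * \<epsilon> powr s) * W)"
        unfolding p' using N0 d by (intro mult_left_mono) auto
      also have "\<dots> = C * \<epsilon> powr s * (d ^ Suc (Suc (a + b)) * W)"
        using d by (simp add: C_def)
      also have "d ^ Suc (Suc (a + b)) * W = cmod (poly p w)"
        using pnorm[of w] unfolding W_def u_def d_def by simp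
      finally show ?thesis .
    qed
    then show ?thesis by blast
  next
    case False
    \<comment> \<open>The distance to either end is at least \<open>\<eta> - 9 * \<epsilon>\<close>,
      and \<open>30 * \<epsilon> < \<eta>\<close>.\<close>
    have x: "7 / 10 * \<eta> \<le> Re v" "7 / 10 * \<eta> \<le> 1 - Re v" using False c e by auto
    have "7 / 20 * \<eta> \<le> Re v * (1 - Re v)"
    proof (cases "1 / 2 \<le> Re v")
      case True
      then have "1 / 2 * (7 / 10 * \<eta>) \<le> Re v * (1 - Re v)" using x e by (intro mult_mono) auto
      then show ?thesis by simp
    next
      case False
      then have "7 / 10 * \<eta> * (1 / 2) \<le> Re v * (1 - Re v)" using x e by (intro mult_mono) auto
      then show ?thesis by simp
    qed
    also have "\<dots> \<le> cmod v * cmod (1 - v)"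
      using x e complex_Re_le_cmod[of v] complex_Re_le_cmod[of "1 - v"]
      by (intro mult_mono) auto
    finally have v: "7 / 20 * \<eta> \<le> cmod v * cmod (1 - v)" .
    \<comment> \<open>The real part gives \<open>8 * \<epsilon>\<close> and the imaginary part
      \<epsilon>; the constant fits since 121/2 times 7/20 exceeds 9.\<close>
    have "cmod (v - of_real c) \<le> 9 * \<epsilon>"
      using cmod_le[of "v - of_real c"] False u(1) by (simp add: v_def)
    also have "\<dots> \<le> 121 / (2 * \<eta>) * \<epsilon> * (7 / 20 * \<eta>)" using e by simp
    also have "\<dots> \<le> 121 / (2 * \<eta>) * \<epsilon> * (cmod v * cmod (1 - v))"
      using e v by (intro mult_left_mono) auto
    finally have "cmod (v - of_real c) * Q \<le> 121 / (2 * \<eta>) * \<epsilon> * (cmod v * cmod (1 - v)) * Q"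
      using Q0 by (intro mult_right_mono)
    then have "cmod (poly (pderiv p) z)
        \<le> N * d ^ Suc (a + b) * (121 / (2 * \<eta>) * \<epsilon> * (cmod v * cmod (1 - v)) * Q)"
      unfolding p' using N0 d by (intro mult_left_mono) auto
    also have "\<dots> = C * (d ^ Suc (Suc (a + b)) * (cmod v ^ Suc a * cmod (1 - v) ^ Suc b))"
      using d by (simp add: C_def Q_def)
    also have "\<dots> = C * cmod (poly p z)"
      using pnorm[of z] unfolding v_def u_def d_def by simp
    finally show ?thesis by simp
  qed
qed

section \<open>Pigeonhole for a short cell of large mass\<close>

text \<open>Half-open cells of length \<epsilon> indexed from 0 to the floor of
  \<open>1 / \<epsilon>\<close> cover \<open>E\<close>, the last one catching the value 1. There are
  at most \<open>2 / \<epsilon>\<close> of them, hence the factor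
  \<open>\<epsilon> / 2\<close>.\<close>

lemma ex_heavy_cell:
  fixes x :: "'a \<Rightarrow> real"
  assumes "finite_measure \<mu>" and x: "x \<in> borel_measurable \<mu>"
    and E: "E \<in> sets \<mu>" "\<And>z. z \<in> E \<Longrightarrow> 0 \<le> x z \<and> x z \<le> 1"
    and m: "measure \<mu> E \<ge> m" "m > 0" and e: "0 < \<epsilon>" "\<epsilon> < 1"
  obtains S where "S \<in> sets \<mu>" "S \<subseteq> E" "measure \<mu> S \<ge> \<epsilon> / 2 * m"
    "\<And>v w. v \<in> S \<Longrightarrow> w \<in> S \<Longrightarrow> \<bar>x v - x w\<bar> \<le> \<epsilon>"
proof -
  interpret finite_measure \<mu> by fact
  define S where "S j = E \<inter> (x -` {real j * \<epsilon>..<real (Suc j) * \<epsilon>} \<inter> space \<mu>)" for j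
  define J where "J = nat \<lfloor>1 / \<epsilon>\<rfloor>"
  have S: "S j \<in> sets \<mu>" for j
    unfolding S_def by (intro sets.Int E(1) measurable_sets[OF x]) simp
  have "E \<subseteq> (\<Union>j\<in>{..J}. S j)"
  proof
    fix z assume z: "z \<in> E"
    define j where "j = nat \<lfloor>x z / \<epsilon>\<rfloor>"
    have "0 \<le> x z / \<epsilon>" "x z / \<epsilon> \<le> 1 / \<epsilon>"
      using E(2)[OF z] e by (auto simp: divide_right_mono)
    then have "real j \<le> x z / \<epsilon>" "x z / \<epsilon> < real (Suc j)" "j \<le> J"
      unfolding j_def J_def by (auto intro!: nat_mono floor_mono) linarith+
    then have "z \<in> S j" "j \<le> J"
      using z e sets.sets_into_space[OF E(1)] by (auto simp: S_def field_simps)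
    then show "z \<in> (\<Union>j\<in>{..J}. S j)" by auto
  qed
  then have "measure \<mu> E \<le> measure \<mu> (\<Union>j\<in>{..J}. S j)"
    using S by (intro finite_measure_mono) auto
  also have "\<dots> \<le> (\<Sum>j\<in>{..J}. measure \<mu> (S j))"
    using S by (intro finite_measure_subadditive_finite) auto
  finally have le: "m \<le> (\<Sum>j\<in>{..J}. measure \<mu> (S j))" using m by linarith
  have "\<exists>j\<in>{..J}. measure \<mu> (S j) \<ge> \<epsilon> / 2 * m"
  proof (rule ccontr)
    assume "\<not> ?thesis"
    then have "measure \<mu> (S j) < \<epsilon> / 2 * m" if "j \<in> {..J}" for j
      using that by (meson not_le)
    then have "(\<Sum>j\<in>{..J}. measure \<mu> (S j)) < (\<Sum>j\<in>{..J}. \<epsilon> / 2 * m)"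
      by (intro sum_strict_mono) blast+
    also have "\<dots> = real (Suc J) * \<epsilon> / 2 * m" by simp
    also have "\<dots> \<le> 1 * m"
    proof (rule mult_right_mono)
      have "real J \<le> 1 / \<epsilon>" using e unfolding J_def by simp
      then have "real J * \<epsilon> \<le> 1" using e by (simp add: field_simps)
      then show "real (Suc J) * \<epsilon> / 2 \<le> 1" using e by (simp add: algebra_simps)
    qed (use m in simp)
    finally show False using le by simp
  qed
  then obtain j where j: "measure \<mu> (S j) \<ge> \<epsilon> / 2 * m" by blast
  show ?thesis
  proof
    show "\<bar>x v - x w\<bar> \<le> \<epsilon>" if "v \<in> S j" "w \<in> S j" for v w
      using that by (auto simp: S_def algebra_simps abs_le_iff)
  qed (use S j in \<open>auto simp: S_def\<close>)
qed

section \<open>The upper bound, with cases according to the size of \<epsilon> against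
  \<eta>\<close>

theorem theorem1:
  fixes K :: "complex set" and A B :: complex and \<mu> :: "complex measure"
    and \<theta> \<delta> :: real and q :: ereal and n :: nat
  assumes "compact K"
    and "set_width K > 0"
    and "A \<in> K" and "B \<in> K" and "cmod (B - A) = diameter K"
    and "finite_measure \<mu>" and "sets \<mu> = sets (restrict_space borel K)"
    and "measure \<mu> K > 0"
    and "0 < \<theta>" and "\<theta> < 1" and "0 < \<delta>" and "\<delta> < 1"
    and "measure \<mu> (middle_part K A B \<delta>) \<ge> \<theta> * measure \<mu> K"
    and "0 < q"
    and "n > 0"
    and "real n \<ge> 2 * (1 + recip_exponent q) * ((diameter K)\<^sup>2 / (set_width K)\<^sup>2)
                    * ln (diameter K / set_width K)"
  shows "turan_constant n q K \<mu>
           \<le> ereal (turan_bound_factor q \<delta> \<theta> * (set_width K / (diameter K)\<^sup>2) * real n)"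
proof -
  interpret finite_measure \<mu> by fact
  define d where "d = diameter K"
  define \<epsilon> where "\<epsilon> = set_width K / d"
  define \<eta> where "\<eta> = (1 - \<delta>) / 2"
  define s where "s = recip_exponent q"
  define u where "u z = (z - A) / (B - A)" for z
  define E where "E = middle_part K A B \<delta>"
  have d: "d > 0"
    unfolding d_def by (rule set_width_pos_imp_diameter_pos[OF assms(1,3,2)])
  have dAB: "cmod (B - A) = d" and AB: "A \<noteq> B" using assms(5) d by (auto simp: d_def)
  have e0: "\<epsilon> > 0" and h: "\<eta> > 0" "\<eta> \<le> 1 / 2" using assms d by (auto simp: \<epsilon>_def \<eta>_def)
  have w: "set_width K = \<epsilon> * d" using d by (simp add: \<epsilon>_def)
  have s0: "0 \<le> s" using \<open>0 < q\<close> by (cases q) (auto simp: s_def recip_exponent_def)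
  have Eiff: "z \<in> E \<longleftrightarrow> z \<in> K \<and> \<eta> \<le> Re (u z) \<and> Re (u z) \<le> 1 - \<eta>" for z
    unfolding E_def \<eta>_def u_def using middle_part_iff[OF assms(5)] d by (simp add: d_def)
  have umeas: "(\<lambda>z. Re (u z)) \<in> borel_measurable \<mu>"
  proof -
    have "(\<lambda>z. Re (u z)) \<in> borel_measurable borel"
      unfolding u_def using AB by (intro borel_measurable_continuous_onI continuous_intros) auto
    then show ?thesis
      unfolding measurable_cong_sets[OF assms(7) refl] by (rule measurable_restrict_space1)
  qed
  have sp: "space \<mu> = K"
    using sets_eq_imp_space_eq[OF assms(7)] by (simp add: space_restrict_space)
  have Emeas: "E \<in> sets \<mu>"
  proof -
    have "E = {z \<in> space \<mu>. \<eta> \<le> Re (u z) \<and> Re (u z) \<le> 1 - \<eta>}" using Eiff sp by auto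
    also have "\<dots> \<in> sets \<mu>" using umeas by measurable
    finally show ?thesis .
  qed
  have Em: "measure \<mu> E \<ge> \<theta> * measure \<mu> K" using assms(13) by (simp add: E_def)
  have rhs: "turan_bound_factor q \<delta> \<theta> * (set_width K / (diameter K)\<^sup>2) * real n
      = 121 / (2 * \<eta>) * \<epsilon> * real n / d * (1 + 2 / \<theta>) powr s"
  proof -
    have "1 - \<delta> = 2 * \<eta>" by (simp add: \<eta>_def)
    then show ?thesis
      using d by (simp add: turan_bound_factor_def s_def w d_def[symmetric] power2_eq_square)
  qed
  show ?thesis
  proof (cases "\<eta> \<le> 30 * \<epsilon>")
    case True
    \<comment> \<open>Points of \<open>R\<close> are at least \<open>d / 2\<close> away from
      \<open>A\<close>, those of \<open>L\<close> at least \<open>d / 2\<close> away from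
      \<open>B\<close>.\<close>
    define R where "R = E \<inter> {z \<in> space \<mu>. 1 / 2 \<le> Re (u z)}"
    define L where "L = E \<inter> {z \<in> space \<mu>. Re (u z) \<le> 1 / 2}"
    have RL: "R \<in> sets \<mu>" "L \<in> sets \<mu>"
      unfolding R_def L_def using umeas by (intro sets.Int Emeas; measurable)+
    have "measure \<mu> E \<le> measure \<mu> (R \<union> L)"
      using RL sp Eiff by (intro finite_measure_mono) (auto simp: R_def L_def)
    also have "\<dots> \<le> measure \<mu> R + measure \<mu> L" using RL by (rule measure_Un_le)
    finally have or: "measure \<mu> R \<ge> \<theta> / 2 * measure \<mu> K \<or> measure \<mu> L \<ge> \<theta> / 2 * measure \<mu> K"
      using Em by argo
    have "turan_constant n q K \<mu> \<le> ereal (2 * real n / d * (1 + 2 / \<theta>) powr s)"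
      using or
    proof
      assume *: "measure \<mu> R \<ge> \<theta> / 2 * measure \<mu> K"
      show ?thesis unfolding s_def
      proof (rule turan_constant_le_one_point[OF assms(1,6,7,8,9,14,3) d assms(15) RL(1) *])
        fix z assume "z \<in> R"
        then have "1 / 2 \<le> cmod (u z)" using complex_Re_le_cmod[of "u z"] by (auto simp: R_def)
        then show "d / 2 \<le> cmod (z - A)" using d dAB by (simp add: u_def norm_divide field_simps)
      qed
    next
      assume *: "measure \<mu> L \<ge> \<theta> / 2 * measure \<mu> K"
      show ?thesis unfolding s_def
      proof (rule turan_constant_le_one_point[OF assms(1,6,7,8,9,14,4) d assms(15) RL(2) *])
        fix z assume "z \<in> L"
        then have "1 / 2 \<le> cmod (u z - 1)"
          using complex_Re_le_cmod[of "1 - u z"] by (auto simp: L_def norm_minus_commute)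
        moreover have "u z - 1 = (z - B) / (B - A)" using AB by (simp add: u_def field_simps)
        ultimately show "d / 2 \<le> cmod (z - B)" using d dAB by (simp add: norm_divide field_simps)
      qed
    qed
    also have "2 * real n / d * (1 + 2 / \<theta>) powr s
        \<le> 121 / (2 * \<eta>) * \<epsilon> * real n / d * (1 + 2 / \<theta>) powr s"
    proof (intro mult_right_mono divide_right_mono)
      \<comment> \<open>The case assumption gives at least 121/60, which is where the threshold 30
        fits the constant 121.\<close>
      show "2 \<le> 121 / (2 * \<eta>) * \<epsilon>" using True h by (simp add: field_simps)
    qed (use d in auto)
    finally show ?thesis unfolding rhs by simp
  next
    case False
    then have e: "0 < \<epsilon>" "30 * \<epsilon> < \<eta>" "\<eta> \<le> 1 / 2" "\<epsilon> < 1 / 60" using e0 h by auto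
    have m0: "\<theta> * measure \<mu> K > 0" using assms by simp
    obtain S where S: "S \<in> sets \<mu>" "S \<subseteq> E" "measure \<mu> S \<ge> \<epsilon> / 2 * (\<theta> * measure \<mu> K)"
      and Sd: "\<And>v w. v \<in> S \<Longrightarrow> w \<in> S \<Longrightarrow> \<bar>Re (u v) - Re (u w)\<bar> \<le> \<epsilon>"
      by (rule ex_heavy_cell[OF \<open>finite_measure \<mu>\<close> umeas Emeas _ Em m0, of \<epsilon>])
        (use Eiff h e in \<open>auto intro: order_trans[of 0 \<eta>]\<close>)
    have "0 < \<epsilon> / 2 * (\<theta> * measure \<mu> K)" by (rule mult_pos_pos[OF _ m0]) (use e in simp)
    then have "S \<noteq> {}" using S(3) by auto
    then obtain z0 where z0: "z0 \<in> S" by auto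
    define x0 where "x0 = Re (u z0)"
    have x0: "\<eta> \<le> x0" "x0 \<le> 1 - \<eta>" using z0 S(2) Eiff by (auto simp: x0_def)
    define L where "L = ln (1 / \<epsilon>)"
    have L: "1 \<le> L"
    proof -
      have "3 \<le> 1 / \<epsilon>" using e by (simp add: field_simps)
      then have "exp 1 \<le> 1 / \<epsilon>" using exp_le by linarith
      then show ?thesis unfolding L_def using e by (simp add: ln_ge_iff)
    qed
    have "2 * (1 + s) * (1 / \<epsilon>\<^sup>2) * L \<le> real n"
      using assms(16) d e by (simp add: w d_def[symmetric] s_def L_def power_mult_distrib)
    then have nL: "2 * (1 + s) * L \<le> real n * \<epsilon>\<^sup>2" using e by (simp add: field_simps)
    have sL: "L \<le> (1 + s) * L" using s0 L by simp
    have "real n * \<epsilon>\<^sup>2 \<le> real n * \<epsilon> * 1"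
      unfolding power2_eq_square mult.assoc[symmetric] using e by (intro mult_left_mono) auto
    \<comment> \<open>Thus rounding to a multiple of \<open>1 / n\<close> moves a point by at most
      \<epsilon>.\<close>
    then have n1: "1 \<le> real n * \<epsilon>" using nL sL L by linarith
    have "2 * ((1 + s) * L) \<le> real n * \<epsilon>\<^sup>2" using nL by (simp only: mult.assoc)
    then have "(1 + s) * L \<le> real n * \<epsilon>\<^sup>2" using sL L by linarith
    then have "exp (- real n * \<epsilon>\<^sup>2) \<le> exp (- ((1 + s) * L))" by simp
    also have "\<dots> = \<epsilon> powr (1 + s)" using e by (simp add: powr_def L_def ln_div)
    also have "\<dots> = \<epsilon> * \<epsilon> powr s" using e by (simp add: powr_add)
    finally have en: "exp (- real n * \<epsilon>\<^sup>2) \<le> \<epsilon> * \<epsilon> powr s" .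
    \<comment> \<open>Rounding down puts \<open>k / n\<close> into the interval from
      \<open>x0 - \<epsilon>\<close> to \<open>x0\<close>; together with the cell length \<epsilon>
      this keeps it within \<open>2 * \<epsilon>\<close> of the whole cell.\<close>
    define k where "k = nat \<lfloor>real n * x0\<rfloor>"
    have nx0: "0 \<le> real n * x0" using x0 h by simp
    have k: "real k \<le> real n * x0" "real n * x0 < real k + 1"
      using nx0 unfolding k_def by linarith+
    \<comment> \<open>Now \<open>n * x0\<close> is at least 30, so \<open>0 < k\<close>; below,
      \<open>x0 < 1\<close> gives \<open>k < n\<close>. Both exponents are therefore positive, as
      the forms \<open>Suc a\<close> and \<open>Suc b\<close> require.\<close>
    have "real n * (30 * \<epsilon>) \<le> real n * x0" using x0 e by (intro mult_left_mono) auto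
    then have "0 < k" using k n1 by (cases k) auto
    then obtain a where a: "k = Suc a" by (cases k) auto
    have "real n * x0 < real n * 1" using x0 h assms(15) by (intro mult_strict_left_mono) auto
    then have "k < n" using k by linarith
    then obtain b where "n = Suc (k + b)" using less_imp_Suc_add by blast
    then have b: "n = Suc a + Suc b" by (simp add: a)
    define c where "c = real (Suc a) / real (Suc a + Suc b)"
    have nc: "real n * c = real k" unfolding c_def a b by simp
    have n0: "real n > 0" using assms(15) by simp
    have "real n * (x0 - \<epsilon>) \<le> real n * c" "real n * c \<le> real n * x0"
      using k n1 nc by (auto simp: algebra_simps)
    then have c: "x0 - \<epsilon> \<le> c" "c \<le> x0" using n0 by auto
    have uK: "\<bar>Im (u z)\<bar> \<le> \<epsilon>" "cmod (u z) \<le> 1" "cmod (1 - u z) \<le> 1" if "z \<in> K" for z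
      using Im_le_set_width[OF assms(1,3,4,5) _ that] d
      by (auto simp: u_def d_def \<epsilon>_def field_simps)
    have Sc: "\<eta> \<le> Re (u z) \<and> Re (u z) \<le> 1 - \<eta> \<and> \<bar>Re (u z) - c\<bar> \<le> 2 * \<epsilon>" if "z \<in> S" for z
      using Sd[OF that z0] S(2) that Eiff c unfolding x0_def by auto
    define p where "p = [:- A, 1:] ^ Suc a * [:- B, 1:] ^ Suc b"
    define C where "C = 121 / (2 * \<eta>) * \<epsilon> * real n / d"
    have C: "C \<ge> 0" using e h d by (simp add: C_def)
    have bound: "cmod (poly (pderiv p) z) \<le> C * cmod (poly p z) \<or>
        (\<forall>w\<in>S. cmod (poly (pderiv p) z) \<le> C * \<epsilon> powr s * cmod (poly p w))" if "z \<in> K" for z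
      by (rule two_point_poly_deriv_bound[OF AB e(1-3), of a b,
            folded c_def p_def u_def b, unfolded dAB, folded C_def])
        (use uK[OF that] Sc c x0 en in auto)
    have nz: "poly p z \<noteq> 0" if "z \<in> S" for z
    proof -
      have "Re (u z) \<noteq> 0" "Re (u z) \<noteq> 1" using Sc[OF that] h by auto
      then have "z \<noteq> A" "z \<noteq> B" using AB by (auto simp: u_def)
      then show ?thesis by (simp add: p_def poly_power)
    qed
    \<comment> \<open>The mass bound of the cell in the form needed for \<kappa> =
      \<epsilon>.\<close>
    have S3: "measure \<mu> S \<ge> \<theta> * \<epsilon> / 2 * measure \<mu> K" using S(3) by (simp add: mult_ac)
    note norm = poly_norm_ratio_le[OF assms(1,6,7,8) S(1) S3 assms(9) e(1) assms(14) C nz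
        bound[unfolded s_def]]
    show ?thesis unfolding rhs s_def C_def[symmetric]
    proof (rule turan_constant_le)
      show "degree p = n"
        unfolding p_def b by (subst degree_mult_eq) (simp_all add: degree_power_eq del: power_Suc)
      show "z \<in> K" if "poly p z = 0" for z
        using that assms(3,4) by (auto simp: p_def poly_power)
    qed (rule norm; assumption)+
  qed
qed

end
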